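(* Let $h^\downarrow:\mathbb Z\to\mathbb R$ be defined by $h^\downarrow(\ell)=2^{-2\ell}\binom{2\ell}{\ell}$ for $\ell\ge0$ and $h^\downarrow(\ell)=0$ for $\ell\le -1$. Let $\nu$ be a probability distribution on $\mathbb Z$ such that $h^\downarrow$ is $\nu$-harmonic on $\mathbb Z_{\ge1}$, i.e. $h^\downarrow(p)=\sum_{k\in\mathbb Z}\nu(k)h^\downarrow(p+k)$ for all $p\ge1$, and such that $\nu$ is not the Dirac mass $\delta_0$ at $0$. Assume that $$\forall k\ge1,\qquad \nu(k-1)\ge \nu(-k-1).$$ Then exactly one of the following holds: (i) $\sum_{k\ge1}k\big(\nu(k-1)-\nu(-k-1)\big)\in[0,1)$ and there exists $c>0$ such that $\nu(-k)\sim \dfrac{c\log k}{k^2}$ as $k\to\infty$; (ii) $\sum_{k\ge1}k\big(\nu(k-1)-\nu(-k-1)\big)=1$ and there exists a slowly varying function $L$ with $L(k)=o(\log k)$ and $1=O(L(k))$ as $k\to\infty$, such that $\nu(-k)\sim \dfrac{L(k)}{k^2}$ as $k\to\infty$.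
   Context: A function $L:\mathbb R_+\to\mathbb R$ is slowly varying if $L(\lambda x)/L(x)\to1$ as $x\to\infty$ for every $\lambda>0$. *)

theory Defs
  imports "HOL-Analysis.Analysis" "HOL-Library.Landau_Symbols"
begin

definition hdown :: "int \<Rightarrow> real" where
  "hdown l = (if l \<ge> 0 then real ((2 * nat l) choose (nat l)) / 2 ^ (2 * nat l) else 0)"

definition slowly_varying :: "(real \<Rightarrow> real) \<Rightarrow> bool" where
  "slowly_varying L \<longleftrightarrow> (\<forall>c>0. ((\<lambda>x. L (c * x) / L x) \<longlongrightarrow> 1) at_top)"

end

theory Submission
  imports Defs "HOL-Real_Asymp.Real_Asymp"
begin

text \<open>
  Write \<open>a\<close> for \<open>hdown\<close>, the coefficients of \<open>(1 - z)\<^sup>-\<^sup>1\<^sup>/\<^sup>2\<close>, and let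
  \<open>F(z) = \<Sum>\<xi>\<^sub>k z\<^sup>k = z (1 - \<Sum>\<nu>(k) z\<^sup>k)\<close>.  Harmonicity of \<open>a\<close> says that
  \<open>F(z) / (1 - 1/z)\<^sup>1\<^sup>/\<^sup>2\<close> has only positive powers of \<open>z\<close>; dividing by \<open>(1 - z)\<^sup>1\<^sup>/\<^sup>2\<close> as well,
  \<open>K = F / \<bar>1 - z\<bar>\<close> is analytic on the disk with real coefficients \<open>\<kappa>\<^sub>n\<close>.  On the unit circle
  the imaginary part of \<open>F\<close> is the sine series with coefficients
  \<open>\<xi>\<^sub>j - \<xi>\<^sub>-\<^sub>j = [j = 1] - \<delta>\<^sub>j\<close>, where \<open>\<delta>\<^sub>j = \<nu>(j - 1) - \<nu>(-j - 1)\<close>; it determines \<open>Im K\<close>,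
  hence \<open>\<kappa>\<close>, and then the negative coefficients of \<open>F = \<bar>1 - z\<bar> K\<close>.  With
  \<open>O\<^sub>k = \<Sum>\<^sub>i\<^sub><\<^sub>k 1 / (2i + 1)\<close> the outcome is
  \<open>\<nu>(-k - 1) = T(1, k) - \<Sum>\<^sub>j\<^sub>\<ge>\<^sub>1 \<delta>\<^sub>j T(j, k)\<close> for the positive kernel
  \<open>T(j, k) = 4 / \<pi>\<^sup>2 \<cdot> j (O\<^sub>k - O\<^sub>j) / (k\<^sup>2 - j\<^sup>2)\<close>.

  Since \<open>\<pi>\<^sup>2 / 4 \<cdot> k\<^sup>2 T(j, k) / j\<close> is within \<open>1\<close> of \<open>O\<^sub>k - O\<^bsub>min j k\<^esub>\<close> and \<open>O\<^sub>k \<sim> 1/2 \<cdot> log k\<close>,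
  Fatou's lemma gives \<open>\<sigma> = \<Sum>j \<delta>\<^sub>j \<le> 1\<close>, and dominated convergence gives
  \<open>\<pi>\<^sup>2 / 4 \<cdot> k\<^sup>2 \<nu>(-k - 1) / O\<^sub>k \<rightarrow> 1 - \<sigma>\<close>.  If \<open>\<sigma> = 1\<close> the logarithms cancel and the same argument
  shows \<open>k\<^sup>2 \<nu>(-k - 1) - L(k) \<rightarrow> 0\<close> for the truncated mean
  \<open>L(k) = 4 / \<pi>\<^sup>2 \<cdot> \<Sum>j \<delta>\<^sub>j (O\<^bsub>min j k\<^esub> - 1)\<close>.
\<close>

section \<open>Central binomial coefficients\<close>

lemma hdown_neg [simp]: "l < 0 \<Longrightarrow> hdown l = 0"
  by (simp add: hdown_def)

lemma hdown_0 [simp]: "hdown 0 = 1"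
  by (simp add: hdown_def)

text \<open>The ratio of neighbouring central binomial coefficients, kept free of division so that
  it holds on all integers; at \<open>l = -1\<close> both sides vanish. All telescoping identities
  below rest on it.\<close>

lemma hdown_step: "(2 * of_int l + 2) * hdown (l + 1) = (2 * of_int l + 1) * hdown l"
proof -
  consider "l < -1" | "l = -1" | "l \<ge> 0" by linarith
  then show ?thesis
  proof cases
    case 3
    then obtain n where n: "l = int n" using nonneg_int_cases by blast
    have 1: "Suc n * ((2 * Suc n) choose Suc n) = 2 * Suc n * ((2 * n + 1) choose n)"
      using Suc_times_binomial_eq[of "2*n+1" n] by (simp add: mult.commute)
    have 2: "Suc n * ((2 * n + 1) choose n) = (2 * n + 1) * ((2 * n) choose n)"
      using binomial_absorb_comp[of "2*n+1" n] by (simp add: algebra_simps)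
    have "Suc n * ((2 * Suc n) choose Suc n) = 2 * (2 * n + 1) * ((2 * n) choose n)"
      using 1 2 by (metis mult.assoc)
    then have "real (Suc n * ((2 * Suc n) choose Suc n)) = real (2 * (2 * n + 1) * ((2 * n) choose n))"
      by (rule arg_cong)
    then have e: "(real n + 1) * real ((2 * Suc n) choose Suc n) = 2 * (2 * real n + 1) * real ((2 * n) choose n)"
      by (simp only: of_nat_mult of_nat_add of_nat_Suc) (simp add: add.commute)
    have s: "hdown (int n + 1) = real ((2 * Suc n) choose Suc n) / (4 * 2 ^ (2 * n))"
      by (simp add: hdown_def nat_add_distrib)
    define u v where "u = real ((2 * Suc n) choose Suc n)" and "v = real ((2 * n) choose n)"
    have h: "hdown (int n) = v / 2 ^ (2 * n)" by (simp add: hdown_def v_def)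
    have e': "(real n + 1) * u = 2 * (2 * real n + 1) * v" using e by (simp only: u_def v_def)
    have "(2 * real n + 2) * (u / (4 * 2 ^ (2 * n))) = ((real n + 1) * u) / (2 * 2 ^ (2 * n))"
      by (simp add: field_simps)
    also have "\<dots> = (2 * real n + 1) * (v / 2 ^ (2 * n))" unfolding e' by (simp add: field_simps)
    finally show ?thesis unfolding n s h u_def[symmetric] by simp
  qed (auto simp: hdown_def)
qed

lemma hdown_nonneg: "hdown l \<ge> 0"
  by (simp add: hdown_def)

lemma hdown_Suc: "hdown (int n + 1) = (2 * real n + 1) / (2 * real n + 2) * hdown (int n)"
  using hdown_step[of "int n"] by (simp add: field_simps)

lemma hdown_decr: "l \<ge> 0 \<Longrightarrow> hdown (l + 1) \<le> hdown l"
proof -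
  assume "l \<ge> 0"
  then obtain n where n: "l = int n" using nonneg_int_cases by blast
  have "(2 * real n + 1) / (2 * real n + 2) * hdown (int n) \<le> 1 * hdown (int n)"
    by (intro mult_right_mono hdown_nonneg) auto
  then show ?thesis by (simp add: n hdown_Suc)
qed

lemma hdown_le_1: "hdown l \<le> 1"
proof (cases "l \<ge> 0")
  case True
  then show ?thesis
  proof (induction l rule: int_ge_induct)
    case (step i)
    then show ?case using hdown_decr[of i] by linarith
  qed simp
qed simp

lemma abs_hdown_le_1: "\<bar>hdown l\<bar> \<le> 1"
  using hdown_le_1[of l] hdown_nonneg[of l] by simp

lemma hdown_pos: "l \<ge> 0 \<Longrightarrow> hdown l > 0"
  by (simp add: hdown_def)

text \<open>From \<open>n\<close> to \<open>n + 1\<close> the two factors change by reciprocal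
  amounts, so the product keeps its initial value 1. Wallis' product then brings pi into the
  asymptotics of \<open>hdown\<close>.\<close>

lemma wallis_hdown: "(\<Prod>k=1..n. (4 * real k ^ 2) / (4 * real k ^ 2 - 1)) * ((2 * real n + 1) * hdown (int n) ^ 2) = 1"
proof (induction n)
  case (Suc n)
  have s: "hdown (int (Suc n)) = (2 * real n + 1) / (2 * real n + 2) * hdown (int n)"
    using hdown_Suc[of n] by (simp add: add.commute)
  define x where "x = real n"
  have x: "x \<ge> 0" by (simp add: x_def)
  have nz: "4 * (x + 1)^2 - 1 = (2*x+1)*(2*x+3)" by (simp add: power2_eq_square algebra_simps)
  have "4 * real (Suc n) ^ 2 / (4 * real (Suc n) ^ 2 - 1) * ((2 * real (Suc n) + 1) * hdown (int (Suc n)) ^ 2)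
     = (2 * real n + 1) * hdown (int n) ^ 2"
  proof -
    have "4 * real (Suc n) ^ 2 / (4 * real (Suc n) ^ 2 - 1) * ((2 * real (Suc n) + 1) * hdown (int (Suc n)) ^ 2)
      = 4 * (x + 1)^2 / ((2*x+1)*(2*x+3)) * ((2*x+3) * ((2 * x + 1) / (2 * x + 2))^2 * hdown (int n)^2)"
      unfolding s power_mult_distrib nz[symmetric] by (simp add: x_def algebra_simps)
    also have "\<dots> = (2 * x + 1) * hdown (int n) ^ 2"
      using x by (simp add: divide_simps power2_eq_square) (simp add: algebra_simps)
    finally show ?thesis by (simp add: x_def)
  qed
  with Suc.IH have "(\<Prod>k=1..n. (4 * real k ^ 2) / (4 * real k ^ 2 - 1)) *
      (4 * real (Suc n) ^ 2 / (4 * real (Suc n) ^ 2 - 1) * ((2 * real (Suc n) + 1) * hdown (int (Suc n)) ^ 2)) = 1"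
    by (simp only:)
  moreover have "(\<Prod>k=1..Suc n. (4 * real k ^ 2) / (4 * real k ^ 2 - 1)) =
      (\<Prod>k=1..n. (4 * real k ^ 2) / (4 * real k ^ 2 - 1)) * (4 * real (Suc n) ^ 2 / (4 * real (Suc n) ^ 2 - 1))"
    by (rule prod.cl_ivl_Suc[THEN trans]) simp
  ultimately show ?case by (simp only: mult.assoc)
qed simp

lemma hdown_sq_limit: "(\<lambda>n. real n * hdown (int n) ^ 2) \<longlonglongrightarrow> 1 / pi"
proof -
  let ?P = "\<lambda>n. \<Prod>k=1..n. (4 * real k ^ 2) / (4 * real k ^ 2 - 1)"
  have "(\<lambda>n. real n / (2 * real n + 1) * inverse (?P n)) \<longlonglongrightarrow> 1 / 2 * inverse (pi / 2)"
  proof (intro tendsto_mult tendsto_inverse)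
    show "(\<lambda>n. real n / (2 * real n + 1)) \<longlonglongrightarrow> 1 / 2" by real_asymp
    show "?P \<longlonglongrightarrow> pi / 2" using wallis by simp
  qed simp
  moreover have "real n / (2 * real n + 1) * inverse (?P n) = real n * hdown (int n) ^ 2" for n
  proof -
    have nz: "2 * real n + 1 \<noteq> 0" by linarith
    have "inverse (?P n) = (2 * real n + 1) * hdown (int n) ^ 2"
      using wallis_hdown[of n] by (rule inverse_unique)
    moreover have "real n / c * (c * h) = real n * h" if "c \<noteq> 0" for c h :: real
      using that by simp
    ultimately show ?thesis using nz by (simp only: not_False_eq_True)
  qed
  moreover have "1 / 2 * inverse (pi / 2) = 1 / pi" by simp
  ultimately show ?thesis by (simp only:)
qed

lemma sqrt_hdown_limit: "((\<lambda>l. sqrt (of_int l) * hdown l) \<longlongrightarrow> sqrt (1 / pi)) at_top"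
proof -
  have "(\<lambda>n. sqrt (real n * hdown (int n) ^ 2)) \<longlonglongrightarrow> sqrt (1 / pi)"
    by (intro tendsto_real_sqrt hdown_sq_limit)
  then have "((\<lambda>n. sqrt (real n) * hdown (int n)) \<longlonglongrightarrow> sqrt (1 / pi))"
    by (simp add: real_sqrt_mult hdown_nonneg)
  then have "filterlim (\<lambda>l. sqrt (real (nat l)) * hdown (int (nat l))) (nhds (sqrt (1 / pi))) at_top"
    by (rule filterlim_compose) (rule filterlim_nat_sequentially)
  then show ?thesis
    by (rule Lim_transform_eventually) (auto intro!: eventually_mono[OF eventually_ge_at_top[of 0]])
qed

lemma filterlim_int_plus: "filterlim (\<lambda>n. int n + c) at_top sequentially"
  unfolding filterlim_at_top
proof
  fix Z :: int
  show "\<forall>\<^sub>F n in sequentially. Z \<le> int n + c"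
    using eventually_ge_at_top[of "nat (Z - c)"] by eventually_elim linarith
qed

text \<open>Boundary terms of the telescoping sums below have this limit, which is the source of the
  factor \<open>1 / pi\<close> in the correlation formulas.\<close>

lemma hdown_prod_limit: "(\<lambda>n. real n * hdown (int n) * hdown (int n + c)) \<longlonglongrightarrow> 1 / pi"
proof -
  have 1: "(\<lambda>n. sqrt (of_int (int n + c)) * hdown (int n + c)) \<longlonglongrightarrow> sqrt (1 / pi)" for c
    by (rule filterlim_compose[OF sqrt_hdown_limit filterlim_int_plus])
  have "(\<lambda>n. sqrt (real n) / sqrt (real n + of_int c)) \<longlonglongrightarrow> 1" by real_asymp
  then have "(\<lambda>n. sqrt (real n) / sqrt (real n + of_int c) * ((sqrt (of_int (int n + 0)) * hdown (int n + 0))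
      * (sqrt (of_int (int n + c)) * hdown (int n + c)))) \<longlonglongrightarrow> 1 * (sqrt (1 / pi) * sqrt (1 / pi))"
    by (intro tendsto_mult 1)
  moreover have "\<forall>\<^sub>F n in sequentially. sqrt (real n) / sqrt (real n + of_int c) * ((sqrt (of_int (int n + 0)) * hdown (int n + 0))
      * (sqrt (of_int (int n + c)) * hdown (int n + c))) = real n * hdown (int n) * hdown (int n + c)"
    using eventually_gt_at_top[of "nat \<bar>c\<bar>"]
  proof eventually_elim
    case (elim n)
    then have "real n + of_int c > 0" by linarith
    then have nz: "sqrt (real n + of_int c) \<noteq> 0" by simp
    have "s / t * ((s * a) * (t * b)) = s * s * a * b" if "t \<noteq> 0" for s t a b :: real
      using that by (simp add: field_simps)
    from this[OF nz] show ?case by simp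
  qed
  ultimately show ?thesis by (simp add: Lim_transform_eventually)
qed

lemma hdown_prod_0: "(\<lambda>n. hdown (int n) * hdown (int n + c)) \<longlonglongrightarrow> 0"
proof -
  have "(\<lambda>n. inverse (real n) * (real n * hdown (int n) * hdown (int n + c))) \<longlonglongrightarrow> 0 * (1 / pi)"
    by (intro tendsto_mult hdown_prod_limit lim_inverse_n)
  moreover have "\<forall>\<^sub>F n in sequentially. inverse (real n) * (real n * hdown (int n) * hdown (int n + c)) = hdown (int n) * hdown (int n + c)"
    using eventually_gt_at_top[of 0] by eventually_elim simp
  ultimately show ?thesis by (simp add: Lim_transform_eventually)
qed

lemma hdown_tendsto_0: "(\<lambda>n. hdown (int n)) \<longlonglongrightarrow> 0"
proof -
  have "(\<lambda>n. sqrt (hdown (int n) * hdown (int n + 0))) \<longlonglongrightarrow> sqrt 0"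
    by (intro tendsto_real_sqrt hdown_prod_0)
  then show ?thesis by (simp add: hdown_nonneg)
qed

section \<open>Sums over the integers and convolution identities\<close>

text \<open>Reduces an unordered sum over the integers to a limit of partial sums; the telescoping
  identities are evaluated this way.\<close>

lemma has_sum_int_sums:
  fixes f :: "int \<Rightarrow> real"
  assumes "f summable_on UNIV" "\<And>l. l < 0 \<Longrightarrow> f l = 0" "(\<lambda>N. \<Sum>l<N. f (int l)) \<longlonglongrightarrow> s"
  shows "(f has_sum s) UNIV"
proof -
  obtain t where t: "(f has_sum t) UNIV" using assms(1) by (auto simp: summable_on_def)
  have b: "bij_betw int UNIV {0..}"
    by (auto simp: bij_betw_def inj_on_def) (metis imageI int_nat_eq UNIV_I)
  have "(f has_sum t) {0..}"
    using t by (rule has_sum_cong_neutral[THEN iffD1, rotated -1]) (auto intro: assms(2))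
  then have "((\<lambda>n. f (int n)) has_sum t) UNIV"
    using has_sum_reindex_bij_betw[OF b, of f t] by simp
  then have "(\<lambda>n. f (int n)) sums t" by (rule has_sum_imp_sums)
  then have "t = s" using assms(3) unfolding sums_def by (rule LIMSEQ_unique)
  with t show ?thesis by simp
qed

lemma has_sum_int_nonneg_sums:
  fixes f :: "int \<Rightarrow> real"
  assumes "\<And>l. l < a \<Longrightarrow> f l = 0" "\<And>l. f l \<ge> 0" "(\<lambda>N. \<Sum>l<N. f (a + int l)) \<longlonglongrightarrow> s"
  shows "(f has_sum s) UNIV"
proof -
  have b: "bij_betw (\<lambda>n. a + int n) UNIV {a..}"
    by (intro bij_betwI[where g="\<lambda>i. nat (i - a)"]) auto
  have "((\<lambda>n. f (a + int n)) has_sum s) UNIV"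
    using assms(3) by (intro sums_nonneg_imp_has_sum) (auto simp: sums_def assms(2))
  then have "(f has_sum s) {a..}"
    using has_sum_reindex_bij_betw[OF b, of f s] by simp
  then show ?thesis
    by (rule has_sum_cong_neutral[THEN iffD1, rotated -1]) (auto intro: assms(1))
qed

lemma has_sum_int_shift: "((\<lambda>l::int. f (l + c)) has_sum s) UNIV \<longleftrightarrow> (f has_sum s) UNIV"
  by (rule has_sum_reindex_bij_betw) (auto intro!: bij_betwI[where g="\<lambda>l. l - c"])

lemma has_sum_int_reflect: "((\<lambda>l::int. f (c - l)) has_sum s) UNIV \<longleftrightarrow> (f has_sum s) UNIV"
  by (rule has_sum_reindex_bij_betw) (auto intro!: bij_betwI[where g="\<lambda>l. c - l"])

lemma summable_int_shift: "(\<lambda>l::int. f (l + c)) summable_on UNIV \<longleftrightarrow> f summable_on UNIV"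
  by (simp add: summable_on_def has_sum_int_shift)

lemma summable_int_reflect: "(\<lambda>l::int. f (c - l)) summable_on UNIV \<longleftrightarrow> f summable_on UNIV"
  by (simp add: summable_on_def has_sum_int_reflect)

lemma infsum_int_shift: "infsum (\<lambda>l::int. f (l + c)) UNIV = infsum f UNIV"
  by (rule infsum_reindex_bij_betw) (auto intro!: bij_betwI[where g="\<lambda>l. l - c"])

lemma infsum_int_reflect: "infsum (\<lambda>l::int. f (c - l)) UNIV = infsum f UNIV"
  by (rule infsum_reindex_bij_betw) (auto intro!: bij_betwI[where g="\<lambda>l. c - l"])

lemma summable_on_abs: "f summable_on A \<Longrightarrow> (\<lambda>x. \<bar>f x :: real\<bar>) summable_on A"
  using summable_on_iff_abs_summable_on_real[of f A] by simp

lemma summable_on_mult_bounded: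
  fixes f g :: "'a \<Rightarrow> real"
  assumes "f summable_on A" "\<And>x. x \<in> A \<Longrightarrow> \<bar>g x\<bar> \<le> C"
  shows "(\<lambda>x. f x * g x) summable_on A"
proof -
  have "(\<lambda>x. C * \<bar>f x\<bar>) summable_on A"
    by (intro summable_on_cmult_right summable_on_abs assms)
  then have "(\<lambda>x. norm (f x * g x)) summable_on A"
  proof (rule summable_on_comparison_test)
    fix x assume "x \<in> A"
    then show "norm (f x * g x) \<le> C * \<bar>f x\<bar>"
      using mult_right_mono[OF assms(2), of x "\<bar>f x\<bar>"] by (simp add: abs_mult mult.commute)
  qed simp
  then show ?thesis by (rule abs_summable_summable)
qed

text \<open>Fubini in the form met throughout: a summable outer weight \<open>u\<close> and rows
  \<open>g n\<close> whose l1 norms share the bound \<open>C\<close> make the double family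
  absolutely summable.\<close>

lemma infsum_swap_bounded:
  fixes u :: "'a \<Rightarrow> real" and g :: "'a \<Rightarrow> 'b \<Rightarrow> real"
  assumes u: "u summable_on A" and g: "\<And>n. n \<in> A \<Longrightarrow> g n summable_on B"
    and C: "\<And>n. n \<in> A \<Longrightarrow> infsum (\<lambda>i. \<bar>g n i\<bar>) B \<le> C"
  shows "infsum (\<lambda>n. u n * infsum (g n) B) A = infsum (\<lambda>i. infsum (\<lambda>n. u n * g n i) A) B"
    and "(\<lambda>i. infsum (\<lambda>n. u n * g n i) A) summable_on B"
proof -
  have "(\<lambda>p. norm (case p of (n, i) \<Rightarrow> u n * g n i)) summable_on A \<times> B"
  proof (subst Infinite_Sum.abs_summable_on_Sigma_iff, intro conjI ballI)
    fix n assume n: "n \<in> A"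
    show "(\<lambda>i. norm (case (n, i) of (n, i) \<Rightarrow> u n * g n i)) summable_on B"
      using g[OF n] by (auto simp: abs_mult intro!: summable_on_cmult_right summable_on_abs)
  next
    have "(\<lambda>n. \<bar>u n\<bar> * infsum (\<lambda>i. \<bar>g n i\<bar>) B) summable_on A"
      by (rule summable_on_mult_bounded[where C = C])
         (auto intro!: summable_on_abs u simp: infsum_nonneg C)
    then have "(\<lambda>n. \<bar>infsum (\<lambda>i. \<bar>u n * g n i\<bar>) B\<bar>) summable_on A"
      by (simp add: abs_mult infsum_cmult_right' infsum_nonneg)
    then show "(\<lambda>n. norm (infsum (\<lambda>i. norm (case (n, i) of (n, i) \<Rightarrow> u n * g n i)) B)) summable_on A"
      by simp
  qed
  then have s: "(\<lambda>(n, i). u n * g n i) summable_on A \<times> B"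
    by (rule abs_summable_summable)
  show "infsum (\<lambda>n. u n * infsum (g n) B) A = infsum (\<lambda>i. infsum (\<lambda>n. u n * g n i) A) B"
    using infsum_swap_banach[OF s] by (simp add: infsum_cmult_right')
  have "(\<lambda>(i, n). u n * g n i) summable_on B \<times> A"
    using s by (subst (asm) summable_on_swap) (simp add: case_prod_unfold)
  then show "(\<lambda>i. infsum (\<lambda>n. u n * g n i) A) summable_on B"
    using summable_on_Sigma_banach[of "\<lambda>i n. u n * g n i" B "\<lambda>_. A"] by simp
qed

section \<open>The coefficients of \<open>(1 - z)^(1/2)\<close> and their correlations\<close>

text \<open>Multiplying \<open>(1 - z)^(-1/2)\<close> by \<open>1 - z\<close> gives
  \<open>(1 - z)^(1/2)\<close>; these are its coefficients.\<close>

definition hdiff :: "int \<Rightarrow> real" where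
  "hdiff l = hdown l - hdown (l - 1)"

lemma hdiff_neg [simp]: "l < 0 \<Longrightarrow> hdiff l = 0"
  by (simp add: hdiff_def)

lemma hdiff_0 [simp]: "hdiff 0 = 1"
  by (simp add: hdiff_def)

lemma hdiff_mult_pred: "2 * of_int l * hdiff l = - hdown (l - 1)"
  using hdown_step[of "l - 1"] by (simp add: hdiff_def algebra_simps)

lemma hdiff_mult: "(2 * of_int l - 1) * hdiff l = - hdown l"
  using hdiff_mult_pred[of l] by (simp add: hdiff_def algebra_simps)

lemma hdiff_step: "(2 * of_int l + 2) * hdiff (l + 1) = (2 * of_int l - 1) * hdiff l"
  using hdiff_mult_pred[of "l + 1"] hdiff_mult[of l] by (simp add: algebra_simps)

lemma hdiff_less_0: "l \<ge> 1 \<Longrightarrow> hdiff l < 0"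
  using hdiff_mult[of l] hdown_pos[of l] by (smt (verit) mult_nonneg_nonneg of_int_1_le_iff)

lemma abs_hdiff_le_1: "\<bar>hdiff l\<bar> \<le> 1"
  using hdown_le_1[of l] hdown_nonneg[of l] hdown_le_1[of "l-1"] hdown_nonneg[of "l-1"]
  by (simp add: hdiff_def)

text \<open>From index 1 on the coefficients are negative and telescope to \<open>-1\<close>,
  because \<open>hdown\<close> tends to 0.\<close>

lemma hdiff_summable: "hdiff summable_on UNIV"
proof -
  have "(\<Sum>l<N. - hdiff (1 + int l)) = 1 - hdown (int N)" for N
    by (induction N) (auto simp: hdiff_def add.commute)
  moreover have "(\<lambda>N. 1 - hdown (int N)) \<longlonglongrightarrow> 1 - 0"
    by (intro tendsto_intros hdown_tendsto_0)
  ultimately have l: "(\<lambda>N. \<Sum>l<N. - hdiff (1 + int l)) \<longlonglongrightarrow> 1" by simp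
  have "((\<lambda>l. if l < 1 then 0 else - hdiff l) has_sum 1) UNIV"
    by (rule has_sum_int_nonneg_sums[where a=1]) (use l hdiff_less_0 in \<open>auto intro: less_imp_le\<close>)
  then have "((\<lambda>l. - hdiff l) has_sum 1) {1..}"
    by (rule has_sum_cong_neutral[THEN iffD1, rotated -1]) auto
  then have "hdiff summable_on {1..}"
    using summable_on_uminus[of "\<lambda>l. - hdiff l" "{1..}"] by (auto simp: summable_on_def)
  moreover have "hdiff summable_on {..0}"
    by (rule summable_on_cong_neutral[THEN iffD1, OF _ _ _ summable_on_finite[of "{0}"]]) auto
  moreover have "UNIV = {..0::int} \<union> {1..}" by auto
  ultimately show ?thesis using summable_on_union by metis
qed

lemma hdiff_shift_summable: "(\<lambda>l. hdiff (l + c)) summable_on UNIV"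
  by (simp add: summable_int_shift hdiff_summable)

lemma hdiff_reflect_summable: "(\<lambda>l. hdiff (c - l)) summable_on UNIV"
  by (simp add: summable_int_reflect hdiff_summable)

text \<open>Coefficientwise form of \<open>(1 - z)^(1/2) (1 - z)^(-1/2) = 1\<close>; it inverts the
  convolutions that define \<open>\<rho>\<close> and \<open>\<kappa>\<close>.\<close>

lemma hdiff_conv_hdown: "((\<lambda>l. hdiff l * hdown (m - l)) has_sum (if m = 0 then 1 else 0)) UNIV"
proof (rule has_sum_int_sums)
  show "(\<lambda>l. hdiff l * hdown (m - l)) summable_on UNIV"
    by (rule summable_on_mult_bounded[OF hdiff_summable, where C=1]) (simp add: abs_hdown_le_1)
  \<comment> \<open>Gosper's algorithm gives the antidifference of the summand.\<close>
  let ?R = "\<lambda>l::int. of_int l * (2 * of_int (m - l) + 1) * hdiff l * hdown (m - l)"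
  have step: "?R (l + 1) - ?R l = - of_int m * (hdiff l * hdown (m - l))" for l
  proof -
    define b a b' a' where "b = hdiff l" and "a = hdown (m - l)" and "b' = hdiff (l + 1)" and "a' = hdown (m - (l + 1))"
    define L M where "L = real_of_int l" and "M = real_of_int m"
    have 1: "(2 * L + 2) * b' = (2 * L - 1) * b"
      using hdiff_step[of l] by (simp add: b_def b'_def L_def)
    have 2: "(2 * (M - L)) * a = (2 * (M - L) - 1) * a'"
      using hdown_step[of "m - l - 1"] by (simp add: a_def a'_def M_def L_def algebra_simps)
    have "(L + 1) * (2 * (M - (L + 1)) + 1) * b' * a' = ((2 * L + 2) * b') * ((2 * (M - L) - 1) * a') / 2"
      by (simp add: algebra_simps)
    also have "\<dots> = (2 * L - 1) * b * ((M - L) * a)"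
      unfolding 1 2[symmetric] by simp
    finally have "(L + 1) * (2 * (M - (L + 1)) + 1) * b' * a' - L * (2 * (M - L) + 1) * b * a = - M * (b * a)"
      by (simp add: algebra_simps)
    then show ?thesis by (simp add: b_def a_def b'_def a'_def L_def M_def)
  qed
  have "of_int m * (\<Sum>l<N. hdiff (int l) * hdown (m - int l)) = - ?R (int N)" for N
  proof (induction N)
    case (Suc N)
    have "int (Suc N) = int N + 1" by simp
    with Suc step[of "int N"] show ?case by (simp only: sum.lessThan_Suc distrib_left)
  qed simp
  \<comment> \<open>The boundary term vanishes once \<open>N\<close> exceeds \<open>m\<close>, since
    then \<open>hdown (m - N) = 0\<close>. This settles \<open>m \<noteq> 0\<close>; for
    \<open>m = 0\<close> only the term \<open>l = 0\<close> survives.\<close>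
  then have 0: "of_int m * (\<Sum>l<N. hdiff (int l) * hdown (m - int l)) = 0" if "int N > m" for N
    using that by simp
  show "(\<lambda>N. \<Sum>l<N. hdiff (int l) * hdown (m - int l)) \<longlonglongrightarrow> (if m = 0 then 1 else 0)"
  proof (rule tendsto_eventually, use eventually_gt_at_top[of "nat \<bar>m\<bar>"] in eventually_elim)
    case (elim N)
    show ?case
    proof (cases "m = 0")
      case True
      have "(\<Sum>l<N. hdiff (int l) * hdown (m - int l)) = (\<Sum>l\<in>{0}. hdiff (int l) * hdown (m - int l))"
        by (rule sum.mono_neutral_right) (use elim True in auto)
      then show ?thesis using True by simp
    next
      case False
      then show ?thesis using 0[of N] elim by simp
    qed
  qed
qed simp

text \<open>On the unit circle \<open>(1 - z)^(1/2) (1 - 1/z)^(1/2) = |1 - z|\<close>, so these are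
  the Fourier coefficients of \<open>2 |sin (t/2)|\<close>. The proof telescopes instead of
  integrating.\<close>

lemma hdiff_corr: "((\<lambda>l. hdiff l * hdiff (l + n)) has_sum 4 / (pi * (1 - 4 * of_int n ^ 2))) UNIV"
proof (rule has_sum_int_sums)
  show "(\<lambda>l. hdiff l * hdiff (l + n)) summable_on UNIV"
    by (rule summable_on_mult_bounded[OF hdiff_summable, where C=1]) (simp add: abs_hdiff_le_1)
  define K where "K = real_of_int n"
  \<comment> \<open>The antidifference \<open>?R\<close> is sought with a linear factor
    \<open>\<alpha> * l + \<beta>\<close>. In its difference the cubic and quadratic coefficients
    cancel by themselves, \<open>\<beta>\<close> kills the linear one, and \<open>\<alpha>\<close>
    makes the constant equal to 1.\<close>
  define \<alpha> \<beta> where "\<alpha> = 16 / (1 - 4 * K ^ 2)" and "\<beta> = \<alpha> * (K / 2 - 3 / 4)"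
  have "2 * n \<noteq> 1 \<and> 2 * n \<noteq> -1" by presburger
  then have "2 * K \<noteq> 1 \<and> 2 * K \<noteq> -1" unfolding K_def by linarith
  then have "(1 - 2 * K) * (1 + 2 * K) \<noteq> 0" by auto
  then have nz: "1 - 4 * K ^ 2 \<noteq> 0" by (simp add: power2_eq_square algebra_simps)
  let ?R = "\<lambda>l::int. of_int l * (of_int l + K) * (\<alpha> * of_int l + \<beta>) * hdiff l * hdiff (l + n)"
  have step: "?R (l + 1) - ?R l = hdiff l * hdiff (l + n)" for l
  proof -
    define b c b' c' where "b = hdiff l" and "c = hdiff (l + n)" and "b' = hdiff (l + 1)" and "c' = hdiff (l + 1 + n)"
    define L where "L = real_of_int l"
    have 1: "(2 * L + 2) * b' = (2 * L - 1) * b"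
      using hdiff_step[of l] by (simp add: b_def b'_def L_def)
    have 2: "(2 * (L + K) + 2) * c' = (2 * (L + K) - 1) * c"
      using hdiff_step[of "l + n"] by (simp add: c_def c'_def K_def L_def algebra_simps)
    have "(L + 1) * (L + 1 + K) * (\<alpha> * (L + 1) + \<beta>) * b' * c'
        = (\<alpha> * (L + 1) + \<beta>) / 4 * ((2 * L + 2) * b') * ((2 * (L + K) + 2) * c')"
      by (simp add: field_simps)
    also have "\<dots> = (\<alpha> * (L + 1) + \<beta>) / 4 * (2 * L - 1) * (2 * (L + K) - 1) * (b * c)"
      unfolding 1 2 by simp
    finally have "(L + 1) * (L + 1 + K) * (\<alpha> * (L + 1) + \<beta>) * b' * c' - L * (L + K) * (\<alpha> * L + \<beta>) * b * c
      = ((\<alpha> * (L + 1) + \<beta>) / 4 * (2 * L - 1) * (2 * (L + K) - 1) - L * (L + K) * (\<alpha> * L + \<beta>)) * (b * c)"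
      by (simp add: algebra_simps)
    also have "(\<alpha> * (L + 1) + \<beta>) / 4 * (2 * L - 1) * (2 * (L + K) - 1) - L * (L + K) * (\<alpha> * L + \<beta>)
        = \<alpha> * (1 - 4 * K ^ 2) / 16"
      unfolding \<beta>_def by (simp add: field_simps power2_eq_square)
    also have "\<dots> = 1" using nz by (simp add: \<alpha>_def)
    finally show ?thesis by (simp add: b_def c_def b'_def c'_def L_def K_def)
  qed
  have eq: "(\<Sum>l<N. hdiff (int l) * hdiff (int l + n)) = ?R (int N)" for N
  proof (induction N)
    case (Suc N)
    then show ?case using step[of "int N"] by (simp add: add.commute)
  qed simp
  \<comment> \<open>\<open>hdiff_mult_pred\<close> turns the boundary term into products of
    \<open>hdown\<close>: times \<open>N\<close> they tend to \<open>1 / pi\<close>, without it to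
    0.\<close>
  have R: "?R (int (Suc N)) = \<alpha> / 4 * (real N * hdown (int N) * hdown (int N + n))
      + (\<alpha> + \<beta>) / 4 * (hdown (int N) * hdown (int N + n))" for N
  proof -
    have "2 * of_int (int (Suc N)) * hdiff (int (Suc N)) = - hdown (int N)"
      using hdiff_mult_pred[of "int (Suc N)"] by simp
    moreover have "2 * of_int (int (Suc N) + n) * hdiff (int (Suc N) + n) = - hdown (int N + n)"
      using hdiff_mult_pred[of "int (Suc N) + n"] by (simp add: add.commute)
    moreover have "x * (x + K) * (\<alpha> * x + \<beta>) * b * c
        = (\<alpha> * x + \<beta>) / 4 * ((2 * x * b) * (2 * (x + K) * c))" for x b c
      by (simp add: field_simps)
    ultimately have "?R (int (Suc N)) = (\<alpha> * of_int (int (Suc N)) + \<beta>) / 4 * (hdown (int N) * hdown (int N + n))"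
      by (simp only: of_int_add K_def minus_mult_minus)
    then show ?thesis by (simp add: algebra_simps add_divide_distrib)
  qed
  have "(\<lambda>N. ?R (int (Suc N))) \<longlonglongrightarrow> \<alpha> / 4 * (1 / pi) + (\<alpha> + \<beta>) / 4 * 0"
    unfolding R by (intro tendsto_intros hdown_prod_limit hdown_prod_0)
  moreover have "\<alpha> / 4 * (1 / pi) + (\<alpha> + \<beta>) / 4 * 0 = 4 / (pi * (1 - 4 * of_int n ^ 2))"
    unfolding \<alpha>_def K_def[symmetric] using nz by (simp add: divide_simps)
  ultimately show "(\<lambda>N. \<Sum>l<N. hdiff (int l) * hdiff (int l + n)) \<longlonglongrightarrow> 4 / (pi * (1 - 4 * of_int n ^ 2))"
    unfolding eq by (intro LIMSEQ_imp_Suc[of "\<lambda>N. ?R (int N)"]) simp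
qed simp

section \<open>Odd harmonic numbers and correlations of \<open>(1 - z)^(-1/2)\<close>\<close>

text \<open>The even extension keeps the recurrence with increment \<open>1 / (2 p + 1)\<close>
  valid for negative \<open>p\<close>, because the increments at \<open>p\<close> and
  \<open>- p - 1\<close> are opposite.\<close>

definition oddharm :: "int \<Rightarrow> real" where
  "oddharm p = (\<Sum>i<nat \<bar>p\<bar>. 1 / (2 * real i + 1))"

lemma oddharm_minus [simp]: "oddharm (- p) = oddharm p"
  by (simp add: oddharm_def)

lemma oddharm_step: "oddharm (p + 1) = oddharm p + 1 / (2 * of_int p + 1)"
proof (cases "p \<ge> 0")
  case True
  then obtain n where p: "p = int n" using nonneg_int_cases by blast
  have "nat \<bar>int n + 1\<bar> = Suc n" by simp
  then show ?thesis unfolding oddharm_def p by simp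
next
  case False
  then have p: "p = - int (nat (- p - 1)) - 1" by simp
  define n where "n = nat (- p - 1)"
  have p: "p = - int n - 1" using p by (simp add: n_def)
  have "nat \<bar>p + 1\<bar> = n" "nat \<bar>p\<bar> = Suc n" using p by auto
  then have "oddharm p = oddharm (p + 1) + 1 / (2 * real n + 1)"
    by (simp only: oddharm_def sum.lessThan_Suc)
  moreover have "1 / (2 * real_of_int p + 1) = - (1 / (2 * real n + 1))"
    unfolding p by (simp add: divide_simps)
  ultimately show ?thesis by simp
qed

text \<open>The sum of \<open>hdown l * hdown (l + c)\<close> diverges like the harmonic series, so
  only differences of correlations make sense. Up to the factor \<open>(2 c + 1) / 2\<close> the
  summand has the antidifference \<open>l * hdown l * hdown (l + c)\<close>, with limit
  \<open>1 / pi\<close>.\<close>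

lemma hdown_corr_step:
  "((\<lambda>l. hdown l * (hdown (l + c) - hdown (l + c + 1))) has_sum 2 / pi * (1 / (2 * of_int c + 1))) UNIV"
proof (rule has_sum_int_sums)
  have "(\<lambda>l. - hdiff (l + (c + 1)) * hdown l) summable_on UNIV"
    by (rule summable_on_mult_bounded[where C=1])
       (auto simp: abs_hdown_le_1 summable_on_uminus hdiff_shift_summable)
  then show "(\<lambda>l. hdown l * (hdown (l + c) - hdown (l + c + 1))) summable_on UNIV"
    by (simp add: hdiff_def algebra_simps)
  define K where "K = real_of_int c"
  have "2 * c \<noteq> -1" by presburger
  then have nz: "2 * K + 1 \<noteq> 0" unfolding K_def by linarith
  have step: "(2 * K + 1) / 2 * (hdown l * (hdown (l + c) - hdown (l + c + 1)))
      = of_int (l + 1) * hdown (l + 1) * hdown (l + 1 + c) - of_int l * hdown l * hdown (l + c)" for l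
  proof -
    define a b a' b' where "a = hdown l" and "b = hdown (l + c)" and "a' = hdown (l + 1)" and "b' = hdown (l + c + 1)"
    define L where "L = real_of_int l"
    have 1: "(L + 1) * a' = (2 * L + 1) / 2 * a"
      using hdown_step[of l] by (simp add: a_def a'_def L_def algebra_simps)
    have 2: "(2 * (L + K) + 1) * b = (2 * (L + K) + 2) * b'"
      using hdown_step[of "l + c"] by (simp add: b_def b'_def L_def K_def algebra_simps)
    have "(L + 1) * a' * b' - L * a * b - (2 * K + 1) / 2 * (a * (b - b'))
       = a / 2 * ((2 * (L + K) + 2) * b' - (2 * (L + K) + 1) * b)"
      unfolding 1 by (simp add: field_simps)
    then have "(2 * K + 1) / 2 * (a * (b - b')) = (L + 1) * a' * b' - L * a * b"
      unfolding 2 by simp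
    then show ?thesis by (simp add: a_def b_def a'_def b'_def L_def add.commute add.left_commute)
  qed
  have eq: "(2 * K + 1) / 2 * (\<Sum>l<N. hdown (int l) * (hdown (int l + c) - hdown (int l + c + 1)))
      = real N * hdown (int N) * hdown (int N + c)" for N
  proof (induction N)
    case (Suc N)
    have "int (Suc N) = int N + 1" "real (Suc N) = of_int (int N + 1)" "real N = of_int (int N)" by simp_all
    with Suc step[of "int N"] show ?case by (simp only: sum.lessThan_Suc distrib_left)
  qed simp
  have "(\<lambda>N. 2 / (2 * K + 1) * (real N * hdown (int N) * hdown (int N + c))) \<longlonglongrightarrow> 2 / (2 * K + 1) * (1 / pi)"
    by (intro tendsto_intros hdown_prod_limit)
  then show "(\<lambda>N. \<Sum>l<N. hdown (int l) * (hdown (int l + c) - hdown (int l + c + 1))) \<longlonglongrightarrow> 2 / pi * (1 / (2 * of_int c + 1))"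
    unfolding eq[symmetric] using nz by (simp add: K_def mult.commute)
qed simp

lemma hdown_corr:
  "((\<lambda>l. hdown l * (hdown (l + p) - hdown (l + q))) has_sum 2 / pi * (oddharm q - oddharm p)) UNIV"
proof -
  have *: "((\<lambda>l. hdown l * (hdown (l + p) - hdown (l + q))) has_sum 2 / pi * (oddharm q - oddharm p)) UNIV" if "p \<le> q" for p q
    using that
  proof (induction q rule: int_ge_induct)
    case (step i)
    have "2 / pi * (oddharm i - oddharm p) + 2 / pi * (1 / (2 * of_int i + 1)) = 2 / pi * (oddharm (i + 1) - oddharm p)"
      unfolding oddharm_step by (simp only: distrib_left[symmetric]) simp
    moreover have "hdown l * (hdown (l + p) - hdown (l + i)) + hdown l * (hdown (l + i) - hdown (l + i + 1))
        = hdown l * (hdown (l + p) - hdown (l + (i + 1)))" for l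
      by (simp add: algebra_simps)
    ultimately show ?case using has_sum_add[OF step.IH hdown_corr_step[of i]] by (simp only:)
  qed simp
  show ?thesis
  proof (cases "p \<le> q")
    case False
    then have "((\<lambda>l. - (hdown l * (hdown (l + q) - hdown (l + p)))) has_sum - (2 / pi * (oddharm p - oddharm q))) UNIV"
      using *[of q p] has_sum_uminus[of "\<lambda>l. hdown l * (hdown (l + q) - hdown (l + p))" UNIV "- (2 / pi * (oddharm p - oddharm q))"]
      by simp
    moreover have "- (2 / pi * (oddharm p - oddharm q)) = 2 / pi * (oddharm q - oddharm p)"
      by (simp only: mult_minus_right[symmetric] minus_diff_eq)
    ultimately show ?thesis by (simp only: mult_minus_right[symmetric] minus_diff_eq)
  qed (rule *)
qed

text \<open>What a unit mass of \<open>\<xi>\<close> at \<open>m\<close> contributes to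
  \<open>\<kappa> n - \<kappa> (- n)\<close>, where \<open>\<kappa>\<close>, introduced below,
  consists of the coefficients of \<open>F / |1 - z|\<close>.\<close>

definition skernel :: "int \<Rightarrow> int \<Rightarrow> real" where
  "skernel m n = 2 / pi * (oddharm (m + n) - oddharm (m - n))"

lemma skernel_has_sum:
  "((\<lambda>i. (hdown (n - i) - hdown (- n - i)) * hdown (m - i)) has_sum skernel m n) UNIV"
proof -
  have "oddharm (- n - m) = oddharm (m + n)" "oddharm (n - m) = oddharm (m - n)"
    by (simp_all add: oddharm_def) (intro sum.cong arg_cong[of _ _ lessThan] arg_cong[of _ _ nat]; simp)+
  then show ?thesis
    using hdown_corr[of "n - m" "- n - m"]
    by (subst has_sum_int_reflect[of _ m, symmetric]) (simp add: skernel_def algebra_simps)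
qed

text \<open>\<open>hdown\<close> decays only like an inverse square root, but a difference of two
  shifts is, up to sign, a finite sum of shifts of \<open>hdiff\<close>.\<close>

lemma hdown_diff_summable: "(\<lambda>l. hdown (l + p) - hdown (l + q)) summable_on UNIV"
proof -
  have *: "(\<lambda>l. hdown (l + p) - hdown (l + q)) summable_on UNIV" if "p \<le> q" for p q
    using that
  proof (induction q rule: int_ge_induct)
    case (step i)
    have "(\<lambda>l. hdown (l + p) - hdown (l + i) + - hdiff (l + (i + 1))) summable_on UNIV"
      using hdiff_shift_summable[of "i + 1"] summable_on_uminus[of "\<lambda>l. hdiff (l + (i + 1))"]
      by (intro summable_on_add step.IH) simp
    then show ?case by (simp add: hdiff_def algebra_simps)
  qed simp
  show ?thesis
  proof (cases "p \<le> q")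
    case False
    then have "(\<lambda>l. - (hdown (l + q) - hdown (l + p))) summable_on UNIV"
      using *[of q p] summable_on_uminus[of "\<lambda>l. hdown (l + q) - hdown (l + p)"] by simp
    then show ?thesis by simp
  qed (rule *)
qed

section \<open>The kernel\<close>

lemma odd_neq_0 [simp]: "2 * real_of_int n + 1 \<noteq> 0" "2 * real_of_int n - 1 \<noteq> 0"
proof -
  have "2 * n \<noteq> -1" "2 * n \<noteq> 1" by presburger+
  then show "2 * real_of_int n + 1 \<noteq> 0" "2 * real_of_int n - 1 \<noteq> 0" by linarith+
qed

lemma oddharm_0 [simp]: "oddharm 0 = 0"
  by (simp add: oddharm_def)

lemma oddharm_mono_abs: "\<bar>p\<bar> \<le> \<bar>q\<bar> \<Longrightarrow> oddharm p \<le> oddharm q"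
  unfolding oddharm_def by (rule sum_mono2) auto

lemma oddharm_nonneg: "oddharm p \<ge> 0"
  unfolding oddharm_def by (rule sum_nonneg) auto

lemma oddharm_diff_limit: "(\<lambda>n. oddharm (int n + p) - oddharm (int n + q)) \<longlonglongrightarrow> 0"
proof -
  have *: "(\<lambda>n. oddharm (int n + q) - oddharm (int n + p)) \<longlonglongrightarrow> 0" if "p \<le> q" for p q
    using that
  proof (induction q rule: int_ge_induct)
    case (step i)
    have "(\<lambda>n. 1 / (2 * (real n + of_int i) + 1)) \<longlonglongrightarrow> 0" by real_asymp
    from tendsto_add[OF step.IH this] show ?case
      using oddharm_step[of "int _ + i"] by (simp add: add.assoc algebra_simps)
  qed simp
  show ?thesis
  proof (cases "p \<le> q")
    case True
    then show ?thesis using tendsto_minus[OF *[of p q]] by simp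
  qed (use * in simp)
qed

lemma skernel_nonneg: "m \<ge> 0 \<Longrightarrow> n \<ge> 0 \<Longrightarrow> skernel m n \<ge> 0"
  unfolding skernel_def by (intro mult_nonneg_nonneg) (auto intro!: oddharm_mono_abs)

lemma skernel_0 [simp]: "skernel 0 n = 0" "skernel m 0 = 0"
  by (simp_all add: skernel_def)

lemma skernel_minus: "skernel (- m) n = - skernel m n"
proof -
  have "oddharm (- m + n) = oddharm (m - n)" "oddharm (- m - n) = oddharm (m + n)"
    using oddharm_minus[of "m - n"] oddharm_minus[of "m + n"] by simp_all
  then show ?thesis by (simp only: skernel_def mult_minus_right[symmetric] minus_diff_eq)
qed

lemma skernel_step: "skernel j (n + 1) = skernel j n
    + 2 / pi * (1 / (2 * of_int (n + j) + 1) - 1 / (2 * of_int (n - j) + 1))"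
proof -
  have "oddharm (j + (n + 1)) = oddharm (j + n) + 1 / (2 * of_int (n + j) + 1)"
    using oddharm_step[of "n + j"] by (simp add: algebra_simps)
  moreover have "oddharm (j - (n + 1)) = oddharm (j - n) + 1 / (2 * of_int (n - j) + 1)"
    using oddharm_step[of "n - j"] oddharm_minus[of "n - j"] oddharm_minus[of "n - j + 1"]
    by (simp add: algebra_simps)
  ultimately have "skernel j (n + 1) = 2 / pi * ((oddharm (j + n) - oddharm (j - n))
       + (1 / (2 * of_int (n + j) + 1) - 1 / (2 * of_int (n - j) + 1)))"
    by (simp add: skernel_def)
  then show ?thesis by (simp only: distrib_left skernel_def)
qed

lemma skernel_limit: "(\<lambda>n. skernel j (int n)) \<longlonglongrightarrow> 0"
proof -
  have e: "oddharm (j - int n) = oddharm (int n + - j)" for n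
    using oddharm_minus[of "j - int n"] by simp
  have "(\<lambda>n. 2 / pi * (oddharm (int n + j) - oddharm (int n + - j))) \<longlonglongrightarrow> 2 / pi * 0"
    by (intro tendsto_mult tendsto_const oddharm_diff_limit)
  then show ?thesis by (simp only: skernel_def e add.commute mult_zero_right)
qed

section \<open>The kernel \<open>T(j, k)\<close> in closed form, and its size\<close>

text \<open>The second factor is minus the Fourier coefficient of \<open>|1 - z|\<close> at
  \<open>n + k\<close> (see \<open>hdiff_corr\<close>); \<open>n\<close> is the intermediate
  frequency when \<open>\<kappa>\<close> is multiplied back by \<open>|1 - z|\<close>.\<close>

definition tterm :: "int \<Rightarrow> int \<Rightarrow> int \<Rightarrow> real" where
  "tterm j k n = skernel j n * (4 / (pi * (4 * of_int (n + k) ^ 2 - 1)))"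

definition tkernel :: "int \<Rightarrow> int \<Rightarrow> real" where
  "tkernel j k = infsum (tterm j k) {1..}"

lemma tterm_nonneg: "j \<ge> 0 \<Longrightarrow> k \<ge> 1 \<Longrightarrow> n \<ge> 0 \<Longrightarrow> tterm j k n \<ge> 0"
proof -
  assume "j \<ge> 0" "k \<ge> 1" "n \<ge> 0"
  moreover from this have "1 \<le> real_of_int (n + k) ^ 2" by (intro one_le_power) simp
  then have "0 \<le> 4 * real_of_int (n + k) ^ 2 - 1" by linarith
  ultimately show ?thesis unfolding tterm_def
    by (intro mult_nonneg_nonneg divide_nonneg_nonneg skernel_nonneg) (auto simp del: of_int_add)
qed

text \<open>Summation by parts in \<open>n\<close>.\<close>
lemma tterm_parts: "tterm j k n = - (2 / pi) * (skernel j (n + 1) / (2 * of_int (n + k) + 1) - skernel j n / (2 * of_int (n + k) - 1))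
   + 4 / pi ^ 2 * (1 / (2 * of_int (n + j) + 1) - 1 / (2 * of_int (n - j) + 1)) / (2 * of_int (n + k) + 1)"
proof -
  define x where "x = 2 * real_of_int (n + k)"
  have nz: "x - 1 \<noteq> 0" "x + 1 \<noteq> 0"
    unfolding x_def by (rule odd_neq_0)+
  define s u where "s = skernel j n" and "u = 1 / (2 * real_of_int (n + j) + 1) - 1 / (2 * of_int (n - j) + 1)"
  have "4 * of_int (n + k) ^ 2 - 1 = (x - 1) * (x + 1)"
    by (simp add: x_def power2_eq_square algebra_simps)
  then have 1: "tterm j k n = s * (4 / (pi * ((x - 1) * (x + 1))))"
    by (simp only: tterm_def s_def)
  have 2: "skernel j (n + 1) = s + 2 / pi * u"
    unfolding s_def u_def by (rule skernel_step)
  have "s * (4 / (pi * ((x - 1) * (x + 1)))) = 2 / pi * (s / (x - 1) - s / (x + 1))"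
    using nz by (simp add: field_simps)
  also have "\<dots> = - (2 / pi) * ((s + 2 / pi * u) / (x + 1) - s / (x - 1)) + 4 / pi ^ 2 * u / (x + 1)"
    by (simp add: add_divide_distrib right_diff_distrib distrib_left power2_eq_square)
  finally show ?thesis unfolding 1 2 by (simp only: s_def u_def x_def)
qed

lemma partial_fraction:
  fixes P a :: real
  assumes "P \<noteq> 0" "a \<noteq> 0" "c \<noteq> 0" "a - P = c"
  shows "1 / P / a = (1 / P - 1 / a) / c"
proof -
  have "1 / P - 1 / a = (a - P) / (P * a)" using assms(1,2) by (simp add: divide_simps)
  then show ?thesis using assms(3,4) by simp
qed

text \<open>An antidifference of two of the three pieces left by summation by parts: the boundary
  product, and the product in \<open>n - j\<close> and \<open>n + k\<close>, to which partial
  fractions apply since \<open>k + j > 0\<close>. The product in \<open>n + j\<close> and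
  \<open>n + k\<close> is treated separately because it depends on whether
  \<open>j = k\<close>.\<close>

definition tprim :: "int \<Rightarrow> int \<Rightarrow> int \<Rightarrow> real" where
  "tprim j k n = - (2 / pi) * (skernel j n / (2 * of_int (n + k) - 1))
     - 4 / pi ^ 2 * ((oddharm (n - j) - oddharm (n + k)) / (2 * (of_int k + of_int j)))"

lemma tprim_step:
  assumes "j \<ge> 1" "k \<ge> 1"
  shows "tterm j k n = tprim j k (n + 1) - tprim j k n
    + 4 / pi ^ 2 * (1 / (2 * of_int (n + j) + 1) / (2 * of_int (n + k) + 1))"
proof -
  have "1 / (2 * of_int (n - j) + 1) / (2 * of_int (n + k) + 1)
    = (1 / (2 * of_int (n - j) + 1) - 1 / (2 * of_int (n + k) + 1)) / (2 * (real_of_int k + of_int j))"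
    using assms by (intro partial_fraction odd_neq_0) auto
  also have "1 / (2 * of_int (n - j) + 1) - 1 / (2 * of_int (n + k) + 1)
    = (oddharm (n + 1 - j) - oddharm (n + 1 + k)) - (oddharm (n - j) - oddharm (n + k))"
    using oddharm_step[of "n - j"] oddharm_step[of "n + k"] by (simp add: algebra_simps)
  finally have *: "1 / (2 * of_int (n - j) + 1) / (2 * of_int (n + k) + 1)
    = (oddharm (n + 1 - j) - oddharm (n + 1 + k)) / (2 * (real_of_int k + of_int j))
     - (oddharm (n - j) - oddharm (n + k)) / (2 * (real_of_int k + of_int j))"
    by (simp only: diff_divide_distrib)
  have **: "2 * real_of_int (n + 1 + k) - 1 = 2 * of_int (n + k) + 1" by simp
  show ?thesis
    unfolding tterm_parts tprim_def ** diff_divide_distrib right_diff_distrib times_divide_eq_right[symmetric] *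
    by (simp only: algebra_simps)
qed

lemma tprim_limit: "(\<lambda>n. tprim j k (int n)) \<longlonglongrightarrow> 0"
proof -
  have 1: "(\<lambda>n. inverse (2 * (real n + of_int k) - 1)) \<longlonglongrightarrow> 0" by real_asymp
  have "(\<lambda>n. - (2 / pi) * (skernel j (int n) * inverse (2 * (real n + of_int k) - 1))
     - 4 / pi ^ 2 * ((oddharm (int n + - j) - oddharm (int n + k)) * inverse (2 * (of_int k + of_int j))))
     \<longlonglongrightarrow> - (2 / pi) * (0 * 0) - 4 / pi ^ 2 * (0 * inverse (2 * (of_int k + of_int j)))"
    by (intro tendsto_diff tendsto_mult tendsto_const 1 oddharm_diff_limit skernel_limit)
  then show ?thesis by (simp add: tprim_def divide_inverse)
qed

lemma tprim_0: "tprim j k 0 = 4 / pi ^ 2 * ((oddharm k - oddharm j) / (2 * (of_int k + of_int j)))"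
  by (simp add: tprim_def minus_divide_left[symmetric] diff_divide_distrib right_diff_distrib)

lemma tterm_0 [simp]: "tterm j k 0 = 0"
  by (simp add: tterm_def)

lemma has_sum_int_pos_sums:
  fixes f :: "int \<Rightarrow> real"
  assumes "\<And>l. l \<ge> 0 \<Longrightarrow> f l \<ge> 0" "f 0 = 0" "(\<lambda>N. \<Sum>l<N. f (int l)) \<longlonglongrightarrow> s"
  shows "(f has_sum s) {1..}"
proof -
  have "((\<lambda>l. if l < 0 then 0 else f l) has_sum s) UNIV"
    by (rule has_sum_int_nonneg_sums[where a=0]) (use assms in auto)
  then show ?thesis
    by (rule has_sum_cong_neutral[THEN iffD1, rotated -1]) (use assms(2) in \<open>auto simp: not_le\<close>, metis int_one_le_iff_zero_less linorder_cases not_less)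
qed

text \<open>Off the diagonal the third piece also splits by partial fractions, with denominator
  \<open>2 (k - j)\<close>, so the whole series telescopes to minus the antidifference at 0.\<close>

lemma tkernel_neq:
  assumes "j \<ge> 1" "k \<ge> 1" "j \<noteq> k"
  shows "(tterm j k has_sum 4 / pi ^ 2 * of_int j * (oddharm k - oddharm j) / (of_int k ^ 2 - of_int j ^ 2)) {1..}"
proof (rule has_sum_int_pos_sums)
  let ?V = "\<lambda>n. tprim j k n + 4 / pi ^ 2 * ((oddharm (n + j) - oddharm (n + k)) / (2 * (of_int k - of_int j)))"
  have step: "tterm j k n = ?V (n + 1) - ?V n" for n
  proof -
    have "1 / (2 * of_int (n + j) + 1) / (2 * of_int (n + k) + 1)
      = (1 / (2 * of_int (n + j) + 1) - 1 / (2 * of_int (n + k) + 1)) / (2 * (real_of_int k - of_int j))"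
      using assms by (intro partial_fraction odd_neq_0) auto
    also have "1 / (2 * of_int (n + j) + 1) - 1 / (2 * of_int (n + k) + 1)
      = (oddharm (n + 1 + j) - oddharm (n + 1 + k)) - (oddharm (n + j) - oddharm (n + k))"
      using oddharm_step[of "n + j"] oddharm_step[of "n + k"] by (simp add: algebra_simps)
    finally have *: "1 / (2 * of_int (n + j) + 1) / (2 * of_int (n + k) + 1)
      = (oddharm (n + 1 + j) - oddharm (n + 1 + k)) / (2 * (real_of_int k - of_int j))
       - (oddharm (n + j) - oddharm (n + k)) / (2 * (real_of_int k - of_int j))"
      by (simp only: diff_divide_distrib)
    show ?thesis
      unfolding tprim_step[OF assms(1,2)] * right_diff_distrib by (simp only: algebra_simps)
  qed
  have eq: "(\<Sum>n<N. tterm j k (int n)) = ?V (int N) - ?V 0" for N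
  proof (induction N)
    case (Suc N)
    have "int (Suc N) = int N + 1" by simp
    with Suc step[of "int N"] show ?case by (simp only: sum.lessThan_Suc)
  qed simp
  have "(\<lambda>N. tprim j k (int N) + 4 / pi ^ 2 * ((oddharm (int N + j) - oddharm (int N + k)) * inverse (2 * (of_int k - of_int j))) - ?V 0)
     \<longlonglongrightarrow> 0 + 4 / pi ^ 2 * (0 * inverse (2 * (of_int k - of_int j))) - ?V 0"
    by (intro tendsto_intros oddharm_diff_limit tprim_limit)
  then have "(\<lambda>N. \<Sum>n<N. tterm j k (int n)) \<longlonglongrightarrow> - ?V 0"
    unfolding eq by (simp add: divide_inverse)
  moreover have "- ?V 0 = 4 / pi ^ 2 * of_int j * (oddharm k - oddharm j) / (of_int k ^ 2 - of_int j ^ 2)"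
  proof -
    define J K D where "J = real_of_int j" and "K = real_of_int k" and "D = oddharm k - oddharm j"
    have nz: "K - J \<noteq> 0" "K + J \<noteq> 0" using assms by (auto simp: J_def K_def)
    have "- ?V 0 = 4 / pi ^ 2 * (D / (2 * (K - J)) - D / (2 * (K + J)))"
      unfolding tprim_0 J_def K_def D_def by (simp add: algebra_simps diff_divide_distrib)
    also have "D / (2 * (K - J)) - D / (2 * (K + J)) = J * D / ((K - J) * (K + J))"
      using nz by (simp add: divide_simps) (simp add: algebra_simps)
    also have "(K - J) * (K + J) = K ^ 2 - J ^ 2" by (simp add: power2_eq_square algebra_simps)
    finally show ?thesis by (simp add: J_def K_def D_def)
  qed
  ultimately show "(\<lambda>N. \<Sum>n<N. tterm j k (int n)) \<longlonglongrightarrow> 4 / pi ^ 2 * of_int j * (oddharm k - oddharm j) / (of_int k ^ 2 - of_int j ^ 2)"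
    by simp
qed (use assms in \<open>auto intro: tterm_nonneg\<close>)

text \<open>On the diagonal the third piece is a series of inverse odd squares; an upper bound of
  order \<open>1 / k\<close> is all that \<open>mkernel_bound\<close> requires.\<close>

lemma tkernel_eq:
  assumes "k \<ge> 1"
  shows "\<exists>s. (tterm k k has_sum s) {1..} \<and> 0 \<le> s \<and> s \<le> 1 / (pi ^ 2 * of_int k)"
proof -
  \<comment> \<open>The correction comes from
    \<open>4 / (2 m + 1)^2 \<le> 1 / m - 1 / (m + 1)\<close> with \<open>m = n + k\<close>.\<close>
  let ?V = "\<lambda>n. tprim k k n - 1 / (pi ^ 2 * of_int (n + k))"
  have step: "tterm k k n \<le> ?V (n + 1) - ?V n" if "n \<ge> 0" for n
  proof -
    define m where "m = real_of_int (n + k)"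
    have m: "m > 0" using assms that by (simp add: m_def)
    have "4 / (2 * m + 1) ^ 2 \<le> 4 / ((2 * m) * (2 * m + 2))"
      using m by (intro divide_left_mono mult_pos_pos zero_less_power) (auto simp: power2_eq_square algebra_simps)
    also have "\<dots> = 1 / m - 1 / (m + 1)" using m by (simp add: divide_simps)
    finally have "4 / (2 * m + 1) ^ 2 / pi ^ 2 \<le> (1 / m - 1 / (m + 1)) / pi ^ 2"
      by (rule divide_right_mono) simp
    moreover have "4 / pi ^ 2 * (1 / (2 * of_int (n + k) + 1) / (2 * of_int (n + k) + 1)) = 4 / (2 * m + 1) ^ 2 / pi ^ 2"
      by (simp add: m_def power2_eq_square)
    moreover have "(1 / m - 1 / (m + 1)) / pi ^ 2 = 1 / (pi ^ 2 * of_int (n + k)) - 1 / (pi ^ 2 * of_int (n + 1 + k))"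
      by (simp add: m_def diff_divide_distrib mult.commute add.commute add.left_commute)
    ultimately show ?thesis unfolding tprim_step[OF assms assms] by linarith
  qed
  have le: "(\<Sum>n<N. tterm k k (int n)) \<le> ?V (int N) - ?V 0" for N
  proof (induction N)
    case (Suc N)
    have "int (Suc N) = int N + 1" by simp
    with Suc step[of "int N"] show ?case by (simp only: sum.lessThan_Suc) simp
  qed simp
  let ?S = "\<lambda>N. \<Sum>n<N. tterm k k (int n)"
  have lim: "(\<lambda>N. ?V (int N) - ?V 0) \<longlonglongrightarrow> 1 / (pi ^ 2 * of_int k)"
  proof -
    have "(\<lambda>N. 1 / (pi ^ 2 * (real N + of_int k))) \<longlonglongrightarrow> 0" by real_asymp
    from tendsto_diff[OF tendsto_diff[OF tprim_limit[of k k] this] tendsto_const[of "?V 0"]]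
    show ?thesis by (simp add: tprim_0)
  qed
  have inc: "incseq ?S"
    by (rule incseq_SucI) (use assms in \<open>auto intro: tterm_nonneg\<close>)
  have "convergent (\<lambda>N. ?V (int N) - ?V 0)" using lim by (auto simp: convergent_def)
  then have "Bseq (\<lambda>N. ?V (int N) - ?V 0)" by (rule convergent_imp_Bseq)
  then obtain B where B: "\<And>N. \<bar>?V (int N) - ?V 0\<bar> \<le> B" by (auto simp: Bseq_def)
  have "?S N \<le> B" for N using le[of N] B[of N] by linarith
  then obtain s where s: "?S \<longlonglongrightarrow> s" using incseq_convergent[OF inc, of B] by blast
  have "s \<le> 1 / (pi ^ 2 * of_int k)" by (rule LIMSEQ_le[OF s lim]) (use le in blast)
  moreover have "0 \<le> s" by (rule LIMSEQ_le_const[OF s]) (use assms in \<open>auto intro!: sum_nonneg tterm_nonneg\<close>)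
  moreover have "(tterm k k has_sum s) {1..}"
    by (rule has_sum_int_pos_sums) (use assms s in \<open>auto intro: tterm_nonneg\<close>)
  ultimately show ?thesis by blast
qed

lemma tterm_summable: "j \<ge> 1 \<Longrightarrow> k \<ge> 1 \<Longrightarrow> tterm j k summable_on {1..}"
  using tkernel_neq[of j k] tkernel_eq[of k] by (cases "j = k") (auto simp: summable_on_def)

text \<open>\<open>mkernel j k\<close> is \<open>k\<^sup>2 / j\<close> times the kernel, normalised to behave like
  \<open>oddharm k - oddharm (min j k)\<close>.\<close>
definition mkernel :: "int \<Rightarrow> int \<Rightarrow> real" where
  "mkernel j k = pi ^ 2 / 4 * of_int k ^ 2 * tkernel j k / of_int j"

lemma mkernel_neq:
  assumes "j \<ge> 1" "k \<ge> 1" "j \<noteq> k"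
  shows "mkernel j k = of_int k ^ 2 * ((oddharm k - oddharm j) / (of_int k ^ 2 - of_int j ^ 2))"
  using assms infsumI[OF tkernel_neq[OF assms]] by (simp add: mkernel_def tkernel_def)

text \<open>Each of the \<open>q - p\<close> increments is at most \<open>1 / (2 p)\<close>. The
  factor \<open>q - p\<close> cancels the singularity of the kernel near the diagonal.\<close>

lemma oddharm_diff_le:
  assumes "1 \<le> p" "p \<le> q"
  shows "oddharm q - oddharm p \<le> (of_int q - of_int p) / (2 * of_int p)"
  using assms(2)
proof (induction q rule: int_ge_induct)
  case (step i)
  have "1 / (2 * of_int i + 1) \<le> 1 / (2 * real_of_int p)"
    using step.hyps assms by (intro divide_left_mono) auto
  then show ?case using step.IH
    by (simp add: oddharm_step add_divide_distrib diff_divide_distrib)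
qed simp

text \<open>Off the diagonal the error is \<open>D * m^2 / |k^2 - j^2|\<close> with
  \<open>m = min j k\<close> and \<open>D\<close> the gap between the two odd harmonic numbers;
  \<open>D \<le> |k - j| / (2 m)\<close> bounds it. Uniformity in \<open>j\<close> is what dominated
  convergence needs.\<close>

lemma mkernel_bound:
  assumes "j \<ge> 1" "k \<ge> 1"
  shows "\<bar>mkernel j k - (oddharm k - oddharm (min j k))\<bar> \<le> 1"
proof -
  define J K where "J = real_of_int j" and "K = real_of_int k"
  have J: "J \<ge> 1" "K \<ge> 1" using assms by (auto simp: J_def K_def)
  consider "j = k" | "j < k" | "k < j" by linarith
  then show ?thesis
  proof cases
    case 1
    obtain s where s: "(tterm k k has_sum s) {1..}" "0 \<le> s" "s \<le> 1 / (pi ^ 2 * K)"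
      using tkernel_eq[OF assms(2)] by (auto simp: K_def)
    have m: "mkernel j k = pi ^ 2 / 4 * K * s"
      using infsumI[OF s(1)] J by (simp add: mkernel_def tkernel_def 1 K_def power2_eq_square)
    also have "\<dots> \<le> pi ^ 2 / 4 * K * (1 / (pi ^ 2 * K))"
      using s J by (intro mult_left_mono) auto
    also have "\<dots> = 1 / 4" using J by simp
    finally have "mkernel j k \<le> 1" by simp
    moreover have "mkernel j k \<ge> 0" unfolding m using s J by simp
    ultimately show ?thesis using 1 by simp
  next
    case 2
    define D where "D = oddharm k - oddharm j"
    have D0: "D \<ge> 0" using 2 assms by (auto simp: D_def intro!: oddharm_mono_abs)
    have JK: "J < K" using 2 by (simp add: J_def K_def)
    have D: "D \<le> (K - J) / (2 * J)" using oddharm_diff_le[of j k] 2 assms by (simp add: D_def J_def K_def)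
    have pos: "K ^ 2 - J ^ 2 > 0" using JK J by (simp add: power_strict_mono)
    have m: "mkernel j k - (oddharm k - oddharm (min j k)) = D * J ^ 2 / (K ^ 2 - J ^ 2)"
      using mkernel_neq[of j k] 2 assms pos
      by (simp add: D_def[symmetric] J_def[symmetric] K_def[symmetric] field_simps)
    have "D * J ^ 2 \<le> (K - J) / (2 * J) * J ^ 2" by (intro mult_right_mono D) simp
    also have "\<dots> = (K - J) * (J / 2)" using J by (simp add: power2_eq_square)
    also have "\<dots> \<le> (K - J) * (K + J)" using J JK by (intro mult_left_mono) auto
    also have "\<dots> = K ^ 2 - J ^ 2" by (simp add: power2_eq_square algebra_simps)
    finally have "D * J ^ 2 / (K ^ 2 - J ^ 2) \<le> 1" using pos by (simp add: field_simps)
    moreover have "D * J ^ 2 / (K ^ 2 - J ^ 2) \<ge> 0" using pos D0 by simp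
    ultimately show ?thesis unfolding m by linarith
  next
    case 3
    define D where "D = oddharm j - oddharm k"
    have D0: "D \<ge> 0" using 3 assms by (auto simp: D_def intro!: oddharm_mono_abs)
    have JK: "K < J" using 3 by (simp add: J_def K_def)
    have D: "D \<le> (J - K) / (2 * K)" using oddharm_diff_le[of k j] 3 assms by (simp add: D_def J_def K_def)
    have pos: "J ^ 2 - K ^ 2 > 0" using JK J by (simp add: power_strict_mono)
    have "mkernel j k = K ^ 2 * ((- D) / (- (J ^ 2 - K ^ 2)))"
      using mkernel_neq[of j k] 3 assms by (simp add: D_def J_def K_def)
    then have m: "mkernel j k - (oddharm k - oddharm (min j k)) = D * K ^ 2 / (J ^ 2 - K ^ 2)"
      using 3 by (simp only: minus_divide_divide) simp
    have "D * K ^ 2 \<le> (J - K) / (2 * K) * K ^ 2" by (intro mult_right_mono D) simp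
    also have "\<dots> = (J - K) * (K / 2)" using J by (simp add: power2_eq_square)
    also have "\<dots> \<le> (J - K) * (J + K)" using J JK by (intro mult_left_mono) auto
    also have "\<dots> = J ^ 2 - K ^ 2" by (simp add: power2_eq_square algebra_simps)
    finally have "D * K ^ 2 / (J ^ 2 - K ^ 2) \<le> 1" using pos by (simp add: field_simps)
    moreover have "D * K ^ 2 / (J ^ 2 - K ^ 2) \<ge> 0" using pos D0 by simp
    ultimately show ?thesis unfolding m by linarith
  qed
qed

section \<open>The representation of the negative tail\<close>

text \<open>As \<open>hdiff l = - hdown l / (2 l - 1)\<close>, a fixed shift does not affect the
  leading order. This drives the Fatou argument in \<open>\<rho>_summable\<close>.\<close>

lemma hdiff_ratio_limit:
  assumes "n \<ge> 0"
  shows "(\<lambda>k. hdiff (int k + n) / hdiff (int k)) \<longlonglongrightarrow> 1"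
proof -
  have h: "hdiff l = - hdown l / (2 * of_int l - 1)" for l
    using hdiff_mult[of l] nonzero_eq_divide_eq[OF odd_neq_0(2)[of l], of "hdiff l" "- hdown l"]
    by (simp only: mult.commute)
  have "(\<lambda>k. (real k * hdown (int k) * hdown (int k + n)) / (real k * hdown (int k) * hdown (int k + 0))
       * ((2 * real k - 1) / (2 * (real k + of_int n) - 1))) \<longlonglongrightarrow> (1 / pi) / (1 / pi) * 1"
  proof (intro tendsto_mult tendsto_divide hdown_prod_limit)
    show "(\<lambda>k. (2 * real k - 1) / (2 * (real k + of_int n) - 1)) \<longlonglongrightarrow> 1" by real_asymp
  qed simp
  moreover have "\<forall>\<^sub>F k in sequentially. (real k * hdown (int k) * hdown (int k + n)) / (real k * hdown (int k) * hdown (int k + 0))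
       * ((2 * real k - 1) / (2 * (real k + of_int n) - 1)) = hdiff (int k + n) / hdiff (int k)"
    using eventually_gt_at_top[of 0]
  proof eventually_elim
    case (elim k)
    have "hdown (int k) > 0" by (rule hdown_pos) simp
    moreover have "2 * real k - 1 \<noteq> 0" "2 * (real k + real_of_int n) - 1 \<noteq> 0"
      using odd_neq_0(2)[of "int k"] odd_neq_0(2)[of "int k + n"] by simp_all
    ultimately show ?case using elim unfolding h by (simp add: field_simps)
  qed
  ultimately show ?thesis by (simp add: Lim_transform_eventually)
qed

lemma has_sum_diff_real:
  fixes f g :: "'a \<Rightarrow> real"
  shows "(f has_sum a) A \<Longrightarrow> (g has_sum b) A \<Longrightarrow> ((\<lambda>x. f x - g x) has_sum (a - b)) A"
  using has_sum_add[of f A a "\<lambda>x. - g x" "- b"] has_sum_uminus[of g A "- b"] by simp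

lemma has_sum_int_fold:
  fixes f :: "int \<Rightarrow> real"
  assumes "(f has_sum s) UNIV" "f 0 = 0"
  shows "((\<lambda>j. f j + f (- j)) has_sum s) {1..}"
proof -
  have sm: "f summable_on UNIV" using assms(1) by (auto simp: summable_on_def)
  have "f summable_on {1..}" "f summable_on {..-1}"
    using summable_on_subset[OF sm] by auto
  then obtain a b where a: "(f has_sum a) {1..}" and b: "(f has_sum b) {..-1}"
    by (auto simp: summable_on_def)
  have "(f has_sum (a + b)) ({1..} \<union> {..-1})"
    by (rule has_sum_Un_disjoint[OF a b]) auto
  then have "(f has_sum (a + b)) UNIV"
  proof (rule has_sum_cong_neutral[THEN iffD1, rotated -1])
    fix i assume "i \<in> UNIV - ({1..} \<union> {..- 1::int})"
    then have "i = 0" by auto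
    then show "f i = 0" using assms(2) by simp
  qed auto
  with assms(1) have s: "s = a + b" by (rule has_sum_unique)
  have "((\<lambda>j. f (- j)) has_sum b) {1..}"
    using b by (subst has_sum_reindex_bij_betw[of uminus "{1..}" "{..-1::int}" f])
       (auto intro!: bij_betwI[where g=uminus])
  from has_sum_add[OF a this] show ?thesis by (simp add: s)
qed

lemma tkernel_nonneg: "j \<ge> 1 \<Longrightarrow> k \<ge> 1 \<Longrightarrow> tkernel j k \<ge> 0"
  unfolding tkernel_def by (rule infsum_nonneg) (auto intro: tterm_nonneg)

text \<open>Uniform in \<open>j\<close> for fixed \<open>k\<close>, so that the sums over
  \<open>j\<close> and over the intermediate frequency can be exchanged.\<close>

lemma tkernel_le:
  assumes "j \<ge> 1" "k \<ge> 1"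
  shows "tkernel j k \<le> 4 / pi ^ 2 * (oddharm k + 1)"
proof (cases "j \<le> k")
  case True
  have "mkernel j k \<le> oddharm k + 1"
    using mkernel_bound[OF assms] oddharm_nonneg[of "min j k"] by linarith
  then have "4 / pi ^ 2 * (of_int j / of_int k ^ 2 * mkernel j k) \<le> 4 / pi ^ 2 * (1 * (oddharm k + 1))"
  proof (intro mult_left_mono mult_mono)
    have "real_of_int j \<le> of_int k * 1" using True by simp
    also have "\<dots> \<le> of_int k * of_int k" using assms by (intro mult_left_mono) auto
    finally show "real_of_int j / of_int k ^ 2 \<le> 1" using assms by (simp add: power2_eq_square)
    show "0 \<le> mkernel j k" unfolding mkernel_def using assms tkernel_nonneg[of j k] by simp
  qed simp_all
  moreover have "4 / pi ^ 2 * (of_int j / of_int k ^ 2 * mkernel j k) = tkernel j k"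
    using assms by (simp add: mkernel_def)
  ultimately show ?thesis by simp
next
  case False
  define J K D where "J = real_of_int j" and "K = real_of_int k" and "D = oddharm j - oddharm k"
  have JK: "1 \<le> K" "K < J" using False assms by (auto simp: J_def K_def)
  have pos: "J ^ 2 - K ^ 2 > 0" using JK by (simp add: power_strict_mono)
  have "D \<le> (J - K) / (2 * K)" using oddharm_diff_le[of k j] False assms by (simp add: D_def J_def K_def)
  also have "\<dots> \<le> (J - K) / 1" using JK by (intro divide_left_mono) auto
  finally have "J * D \<le> (J + K) * (J - K)" using JK by (intro mult_mono) (auto simp: D_def False intro!: oddharm_mono_abs, use False assms in auto)
  also have "\<dots> = J ^ 2 - K ^ 2" by (simp add: power2_eq_square algebra_simps)
  finally have "J * D / (J ^ 2 - K ^ 2) \<le> 1" using pos by simp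
  also have "1 \<le> oddharm k + 1" by (simp add: oddharm_nonneg)
  finally have "4 / pi ^ 2 * (J * D / (J ^ 2 - K ^ 2)) \<le> 4 / pi ^ 2 * (oddharm k + 1)"
    by (intro mult_left_mono) auto
  moreover have "tkernel j k = 4 / pi ^ 2 * (J * (- D) / (- (J ^ 2 - K ^ 2)))"
    using infsumI[OF tkernel_neq[OF assms]] False by (simp add: tkernel_def J_def K_def D_def)
  ultimately show ?thesis by (simp only: mult_minus_right minus_divide_divide)
qed

lemma has_sum_single: "((\<lambda>m. if m = a then f m else 0) has_sum f a) (UNIV :: 'b set)" for f :: "'b \<Rightarrow> real"
  by (rule has_sum_finite_neutralI[of "{a}"]) auto

lemma abs_infsum_le: "f summable_on A \<Longrightarrow> \<bar>infsum f A\<bar> \<le> infsum (\<lambda>y. \<bar>f y\<bar>) A" for f :: "'b \<Rightarrow> real"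
  using norm_infsum_bound[of f A] summable_on_abs[of f A] by simp

section \<open>Factorisation of \<open>F\<close> and the representation formula\<close>

locale hdown_harmonic =
  fixes \<nu> :: "int \<Rightarrow> real"
  assumes nonneg: "\<And>k. \<nu> k \<ge> 0"
    and prob: "(\<nu> has_sum 1) UNIV"
    and harmonic: "\<And>p. p \<ge> 1 \<Longrightarrow> ((\<lambda>k. \<nu> k * hdown (p + k)) has_sum hdown p) UNIV"
begin

text \<open>The factor \<open>z\<close> in \<open>F\<close> shifts indices by one, so that
  harmonicity at all \<open>p \<ge> 1\<close> becomes the vanishing of \<open>\<rho> n\<close> for
  all \<open>n \<le> 0\<close>.\<close>

definition \<xi> :: "int \<Rightarrow> real" where
  "\<xi> m = (if m = 1 then 1 else 0) - \<nu> (m - 1)"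

text \<open>The generating series is \<open>F(z) (1 - 1/z)^(-1/2)\<close>; one more factor
  \<open>(1 - z)^(-1/2)\<close> turns it into that of \<open>\<kappa>\<close>, namely
  \<open>F(z) / |1 - z|\<close>.\<close>

definition \<rho> :: "int \<Rightarrow> real" where
  "\<rho> n = infsum (\<lambda>m. \<xi> m * hdown (m - n)) UNIV"

definition \<kappa> :: "int \<Rightarrow> real" where
  "\<kappa> n = infsum (\<lambda>i. \<rho> i * hdown (n - i)) UNIV"

lemma \<nu>_shift_summable: "(\<lambda>m. \<nu> (m + c)) summable_on UNIV"
  using prob unfolding summable_int_shift by (auto simp: summable_on_def)

lemma \<xi>_summable: "\<xi> summable_on UNIV"
proof -
  obtain a where "((\<lambda>m. \<nu> (m + - 1)) has_sum a) UNIV"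
    using \<nu>_shift_summable[of "- 1"] by (auto simp: summable_on_def)
  from has_sum_diff_real[OF has_sum_single[of 1 "\<lambda>_. 1"] this] show ?thesis
    by (auto simp: summable_on_def \<xi>_def[abs_def])
qed

lemma \<xi>_mult_summable: "(\<lambda>m. \<xi> m * hdown (m - n)) summable_on UNIV"
  by (rule summable_on_mult_bounded[OF \<xi>_summable, of _ 1]) (simp add: abs_hdown_le_1)

lemma \<rho>_eq: "\<rho> n = hdown (1 - n) - infsum (\<lambda>k. \<nu> k * hdown (1 - n + k)) UNIV"
proof -
  have "(\<lambda>k. \<nu> k * hdown (1 - n + k)) summable_on UNIV"
    using prob by (intro summable_on_mult_bounded[of \<nu> _ _ 1]) (auto simp: summable_on_def abs_hdown_le_1)
  then have "((\<lambda>k. \<nu> k * hdown (1 - n + k)) has_sum infsum (\<lambda>k. \<nu> k * hdown (1 - n + k)) UNIV) UNIV"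
    by simp
  then have "((\<lambda>m. \<nu> (m + - 1) * hdown (1 - n + (m + - 1))) has_sum infsum (\<lambda>k. \<nu> k * hdown (1 - n + k)) UNIV) UNIV"
    by (subst has_sum_int_shift[of "\<lambda>k. \<nu> k * hdown (1 - n + k)"])
  from has_sum_diff_real[OF has_sum_single[of 1 "\<lambda>m. hdown (m - n)"] this]
  have "((\<lambda>m. \<xi> m * hdown (m - n)) has_sum hdown (1 - n) - infsum (\<lambda>k. \<nu> k * hdown (1 - n + k)) UNIV) UNIV"
    by (rule has_sum_cong[THEN iffD1, rotated]) (simp add: \<xi>_def algebra_simps)
  then show ?thesis unfolding \<rho>_def by (rule infsumI)
qed

lemma \<rho>_nonpos: "n \<le> 0 \<Longrightarrow> \<rho> n = 0"
  using infsumI[OF harmonic[of "1 - n"]] by (simp add: \<rho>_eq)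

lemma \<rho>_le: "\<rho> n \<le> (if n = 1 then 1 else 0)"
proof (cases "n \<le> 0")
  case False
  have "0 \<le> infsum (\<lambda>k. \<nu> k * hdown (1 - n + k)) UNIV"
    by (intro infsum_nonneg mult_nonneg_nonneg nonneg hdown_nonneg)
  with False show ?thesis by (auto simp: \<rho>_eq)
qed (simp add: \<rho>_nonpos)

lemma \<rho>_bounded: "\<bar>\<rho> n\<bar> \<le> infsum (\<lambda>m. \<bar>\<xi> m\<bar>) UNIV"
proof -
  have "\<bar>\<rho> n\<bar> \<le> infsum (\<lambda>m. \<bar>\<xi> m * hdown (m - n)\<bar>) UNIV"
    unfolding \<rho>_def by (rule abs_infsum_le[OF \<xi>_mult_summable])
  also have "\<dots> \<le> infsum (\<lambda>m. \<bar>\<xi> m\<bar>) UNIV"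
    by (intro infsum_mono summable_on_abs \<xi>_mult_summable \<xi>_summable)
       (auto simp: abs_mult abs_hdown_le_1 mult_left_le)
  finally show ?thesis .
qed

text \<open>Multiplication by \<open>(1 - 1/z)^(1/2)\<close> undoes the first division: after
  exchanging sums, \<open>hdiff_conv_hdown\<close> leaves only \<open>m = k\<close>.\<close>

lemma \<xi>_eq: "\<xi> k = infsum (\<lambda>l. hdiff l * \<rho> (k + l)) UNIV"
proof -
  have "infsum (\<lambda>l. hdiff l * infsum (\<lambda>m. \<xi> m * hdown (m - (k + l))) UNIV) UNIV
      = infsum (\<lambda>m. infsum (\<lambda>l. hdiff l * (\<xi> m * hdown (m - (k + l)))) UNIV) UNIV"
  proof (rule infsum_swap_bounded(1)[OF hdiff_summable \<xi>_mult_summable])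
    show "infsum (\<lambda>m. \<bar>\<xi> m * hdown (m - (k + l))\<bar>) UNIV \<le> infsum (\<lambda>m. \<bar>\<xi> m\<bar>) UNIV" for l
      by (intro infsum_mono summable_on_abs \<xi>_mult_summable \<xi>_summable)
         (auto simp: abs_mult abs_hdown_le_1 mult_left_le)
  qed
  also have "(\<lambda>m. infsum (\<lambda>l. hdiff l * (\<xi> m * hdown (m - (k + l)))) UNIV) = (\<lambda>m. if m = k then \<xi> m else 0)"
  proof
    fix m
    have "infsum (\<lambda>l. hdiff l * (\<xi> m * hdown (m - (k + l)))) UNIV
        = infsum (\<lambda>l. \<xi> m * (hdiff l * hdown (m - k - l))) UNIV"
      by (simp add: algebra_simps)
    also have "\<dots> = \<xi> m * (if m - k = 0 then 1 else 0)"
      by (simp only: infsum_cmult_right' infsumI[OF hdiff_conv_hdown])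
    finally show "infsum (\<lambda>l. hdiff l * (\<xi> m * hdown (m - (k + l)))) UNIV = (if m = k then \<xi> m else 0)"
      by simp
  qed
  also have "infsum (\<lambda>m. if m = k then \<xi> m else 0) UNIV = \<xi> k"
    by (rule infsumI) (rule has_sum_single)
  finally show ?thesis unfolding \<rho>_def by simp
qed

lemma \<xi>_minus_has_sum: "((\<lambda>n. hdiff (n + k) * \<rho> n) has_sum \<xi> (- k)) UNIV"
proof -
  have "(\<lambda>n. hdiff (n + k) * \<rho> n) summable_on UNIV"
    by (rule summable_on_mult_bounded[OF hdiff_shift_summable \<rho>_bounded])
  then have "((\<lambda>n. hdiff (n + k) * \<rho> n) has_sum infsum (\<lambda>n. hdiff (n + k) * \<rho> n) UNIV) UNIV"
    by simp
  also have "infsum (\<lambda>n. hdiff (n + k) * \<rho> n) UNIV = \<xi> (- k)"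
    unfolding \<xi>_eq by (subst infsum_int_shift[of _ k, symmetric]) simp
  finally show ?thesis .
qed

lemma \<xi>_minus: "k \<ge> 0 \<Longrightarrow> \<xi> (- k) = - \<nu> (- k - 1)"
  by (simp add: \<xi>_def)

text \<open>A Fatou argument. \<open>R n = [n = 1] - \<rho> n\<close> is nonnegative, and
  \<open>\<xi> (- k) \<le> 0\<close> bounds the sum of
  \<open>R n * hdiff (n + k) / hdiff (1 + k)\<close> by 1 for every \<open>k\<close>. The ratios
  tend to 1 as \<open>k\<close> grows, so \<open>R\<close> has total mass at most 1.\<close>

lemma \<rho>_summable: "\<rho> summable_on UNIV"
proof -
  define R where "R n = (if n = 1 then 1 else 0) - \<rho> n" for n
  have R0: "R n = 0" if "n \<le> 0" for n using that by (simp add: R_def \<rho>_nonpos)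
  have Rn: "R n \<ge> 0" for n using \<rho>_le[of n] by (simp add: R_def)
  have fin: "(\<Sum>n\<in>F. R n * (hdiff (n + int k) / hdiff (1 + int k))) \<le> 1" if F: "finite F" for F k
  proof -
    have "((\<lambda>n. (if n = 1 then hdiff (n + int k) else 0) - hdiff (n + int k) * \<rho> n) has_sum hdiff (1 + int k) - \<xi> (- int k)) UNIV"
      by (rule has_sum_diff_real[OF has_sum_single \<xi>_minus_has_sum])
    then have "((\<lambda>n. - (hdiff (n + int k) * R n)) has_sum - (hdiff (1 + int k) - \<xi> (- int k))) UNIV"
      by (subst has_sum_uminus) (simp, rule has_sum_cong[THEN iffD1, rotated], assumption, simp add: R_def algebra_simps)
    moreover have t: "- (hdiff (n + int k) * R n) \<ge> 0" for n
    proof (cases "n \<le> 0")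
      case False
      then have "hdiff (n + int k) < 0" by (intro hdiff_less_0) simp
      then show ?thesis using Rn[of n] by (simp add: mult_nonpos_nonneg)
    qed (simp add: R0)
    ultimately have "(\<Sum>n\<in>F. - (hdiff (n + int k) * R n)) \<le> - (hdiff (1 + int k) - \<xi> (- int k))"
      by (intro finite_sum_le_has_sum F) auto
    also have "\<dots> \<le> - hdiff (1 + int k)" using nonneg[of "- int k - 1"] by (simp add: \<xi>_minus)
    finally have *: "(\<Sum>n\<in>F. - (hdiff (n + int k) * R n)) \<le> - hdiff (1 + int k)" .
    have neg: "hdiff (1 + int k) < 0" by (rule hdiff_less_0) simp
    have "(\<Sum>n\<in>F. R n * (hdiff (n + int k) / hdiff (1 + int k)))
        = (\<Sum>n\<in>F. - (hdiff (n + int k) * R n)) / (- hdiff (1 + int k))"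
      by (simp add: sum_divide_distrib sum_negf mult.commute)
    also have "\<dots> \<le> 1" using * neg by (subst pos_divide_le_eq) auto
    finally show ?thesis .
  qed
  have "sum R F \<le> 1" if F: "finite F" for F
  proof -
    have "(\<lambda>k. \<Sum>n\<in>F. R n * (hdiff (n + int k) / hdiff (1 + int k))) \<longlonglongrightarrow> (\<Sum>n\<in>F. R n)"
    proof (rule tendsto_sum)
      fix n
      show "(\<lambda>k. R n * (hdiff (n + int k) / hdiff (1 + int k))) \<longlonglongrightarrow> R n"
      proof (cases "n \<le> 0")
        case False
        \<comment> \<open>Writing \<open>1 + k\<close> as \<open>Suc k\<close> leaves the shift
          \<open>n - 1\<close>, which is nonnegative here.\<close>
        have "(\<lambda>k. R n * (hdiff (int (Suc k) + (n - 1)) / hdiff (int (Suc k)))) \<longlonglongrightarrow> R n * 1"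
          by (intro tendsto_intros LIMSEQ_Suc[OF hdiff_ratio_limit]) (use False in simp)
        then show ?thesis by (simp add: algebra_simps)
      qed (simp add: R0)
    qed
    then show ?thesis by (rule LIMSEQ_le_const2) (use fin[OF F] in blast)
  qed
  then have "R summable_on UNIV"
    by (intro nonneg_bdd_above_summable_on Rn bdd_aboveI[of _ 1]) auto
  then obtain s where "(R has_sum s) UNIV" by (auto simp: summable_on_def)
  from has_sum_diff_real[OF has_sum_single[of 1 "\<lambda>_. 1"] this] show ?thesis
    by (auto simp: summable_on_def R_def[abs_def])
qed

lemma \<rho>_mult_summable: "(\<lambda>i. \<rho> i * hdown (n - i)) summable_on UNIV"
  by (rule summable_on_mult_bounded[OF \<rho>_summable, of _ 1]) (simp add: abs_hdown_le_1)

lemma \<rho>_mult_le: "infsum (\<lambda>i. \<bar>\<rho> i * hdown (n - i)\<bar>) UNIV \<le> infsum (\<lambda>i. \<bar>\<rho> i\<bar>) UNIV"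
  by (intro infsum_mono summable_on_abs \<rho>_mult_summable \<rho>_summable)
     (auto simp: abs_mult abs_hdown_le_1 mult_left_le)

lemma \<kappa>_bounded: "\<bar>\<kappa> n\<bar> \<le> infsum (\<lambda>i. \<bar>\<rho> i\<bar>) UNIV"
  using abs_infsum_le[OF \<rho>_mult_summable[of n]] \<rho>_mult_le[of n] by (simp add: \<kappa>_def)

lemma \<kappa>_nonpos: "n \<le> 0 \<Longrightarrow> \<kappa> n = 0"
  unfolding \<kappa>_def by (intro infsum_0) (metis hdown_neg mult_eq_0_iff \<rho>_nonpos diff_less_0_iff_less linorder_not_le order_le_less_trans)

text \<open>As \<open>\<kappa>\<close> vanishes at nonpositive indices, subtracting
  \<open>\<kappa> (- n)\<close> costs nothing, and it replaces the weight
  \<open>hdown (n - i)\<close> by a summable difference of shifts, which makes the exchange of sums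
  legitimate.\<close>

lemma \<kappa>_has_sum:
  assumes "n \<ge> 0"
  shows "((\<lambda>m. \<xi> m * skernel m n) has_sum \<kappa> n) UNIV"
proof -
  let ?u = "\<lambda>i. hdown (n - i) - hdown (- n - i)"
  have u: "?u summable_on UNIV"
    using summable_int_reflect[of "\<lambda>l. hdown (l + n) - hdown (l + - n)" 0] hdown_diff_summable[of n "- n"]
    by (simp only: add.commute diff_conv_add_uminus add_0)
  have "\<kappa> n = \<kappa> n - \<kappa> (- n)" using assms by (simp add: \<kappa>_nonpos)
  also have "\<dots> = infsum (\<lambda>i. \<rho> i * hdown (n - i) - \<rho> i * hdown (- n - i)) UNIV"
    unfolding \<kappa>_def by (intro infsumI[symmetric] has_sum_diff_real has_sum_infsum \<rho>_mult_summable)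
  also have "\<dots> = infsum (\<lambda>i. ?u i * infsum (\<lambda>m. \<xi> m * hdown (m - i)) UNIV) UNIV"
    unfolding \<rho>_def by (simp add: algebra_simps)
  finally have 1: "\<kappa> n = \<dots>" .
  have C: "infsum (\<lambda>m. \<bar>\<xi> m * hdown (m - l)\<bar>) UNIV \<le> infsum (\<lambda>m. \<bar>\<xi> m\<bar>) UNIV" for l
    by (intro infsum_mono summable_on_abs \<xi>_mult_summable \<xi>_summable)
       (auto simp: abs_mult abs_hdown_le_1 mult_left_le)
  note swap = infsum_swap_bounded[where g="\<lambda>i m. \<xi> m * hdown (m - i)", OF u \<xi>_mult_summable C]
  have inner: "infsum (\<lambda>i. ?u i * (\<xi> m * hdown (m - i))) UNIV = \<xi> m * skernel m n" for m
  proof -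
    have "infsum (\<lambda>i. ?u i * (\<xi> m * hdown (m - i))) UNIV = infsum (\<lambda>i. \<xi> m * (?u i * hdown (m - i))) UNIV"
      by (simp add: algebra_simps)
    also have "\<dots> = \<xi> m * skernel m n"
      by (simp only: infsum_cmult_right' infsumI[OF skernel_has_sum])
    finally show ?thesis .
  qed
  from swap(1) swap(2) show ?thesis unfolding inner 1 by simp
qed

text \<open>Multiplication by \<open>(1 - z)^(1/2)\<close> undoes the second division.\<close>

lemma \<rho>_conv: "\<rho> n = infsum (\<lambda>i. \<kappa> i * hdiff (n - i)) UNIV"
proof -
  have "infsum (\<lambda>i. hdiff (n - i) * infsum (\<lambda>q. \<rho> q * hdown (i - q)) UNIV) UNIV
      = infsum (\<lambda>q. infsum (\<lambda>i. hdiff (n - i) * (\<rho> q * hdown (i - q))) UNIV) UNIV"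
    by (rule infsum_swap_bounded(1)[OF hdiff_reflect_summable \<rho>_mult_summable \<rho>_mult_le])
  also have "(\<lambda>q. infsum (\<lambda>i. hdiff (n - i) * (\<rho> q * hdown (i - q))) UNIV) = (\<lambda>q. if q = n then \<rho> q else 0)"
  proof
    fix q
    have "infsum (\<lambda>i. hdiff (n - i) * (\<rho> q * hdown (i - q))) UNIV
        = infsum (\<lambda>l. \<rho> q * (hdiff l * hdown (n - q - l))) UNIV"
      by (subst infsum_int_reflect[of _ n, symmetric]) (simp add: algebra_simps)
    also have "\<dots> = \<rho> q * (if n - q = 0 then 1 else 0)"
      by (simp only: infsum_cmult_right' infsumI[OF hdiff_conv_hdown])
    finally show "infsum (\<lambda>i. hdiff (n - i) * (\<rho> q * hdown (i - q))) UNIV = (if q = n then \<rho> q else 0)"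
      by simp
  qed
  also have "infsum (\<lambda>q. if q = n then \<rho> q else 0) UNIV = \<rho> n"
    by (rule infsumI) (rule has_sum_single)
  finally show ?thesis unfolding \<kappa>_def by (simp add: mult.commute)
qed

text \<open>The coefficient of \<open>z^(-k)\<close> in \<open>F = |1 - z| K\<close>: inserting
  \<open>\<rho>_conv\<close> into \<open>\<xi>_minus_has_sum\<close> correlates two copies of
  \<open>hdiff\<close>, and \<open>hdiff_corr\<close> evaluates the result.\<close>

lemma \<xi>_minus_\<kappa>: "((\<lambda>i. \<kappa> i * (4 / (pi * (4 * of_int (i + k) ^ 2 - 1)))) has_sum - \<xi> (- k)) {1..}"
proof -
  define C where "C = infsum (\<lambda>i. \<bar>\<rho> i\<bar>) UNIV * infsum (\<lambda>i. \<bar>hdiff i\<bar>) UNIV"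
  have s: "(\<lambda>i. \<kappa> i * hdiff (n - i)) summable_on UNIV" for n
    using summable_on_mult_bounded[where g=\<kappa>, OF hdiff_reflect_summable[of n] \<kappa>_bounded] by (simp add: mult.commute)
  have C: "infsum (\<lambda>i. \<bar>\<kappa> i * hdiff (n - i)\<bar>) UNIV \<le> C" for n
  proof -
    have "infsum (\<lambda>i. \<bar>\<kappa> i * hdiff (n - i)\<bar>) UNIV \<le> infsum (\<lambda>i. infsum (\<lambda>i. \<bar>\<rho> i\<bar>) UNIV * \<bar>hdiff (n - i)\<bar>) UNIV"
      by (intro infsum_mono summable_on_abs s summable_on_cmult_right hdiff_reflect_summable)
         (auto simp: abs_mult intro!: mult_right_mono \<kappa>_bounded)
    also have "\<dots> = C"
      by (simp only: infsum_cmult_right' C_def infsum_int_reflect[of "\<lambda>i. \<bar>hdiff i\<bar>" n])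
    finally show ?thesis .
  qed
  note swap = infsum_swap_bounded[where g="\<lambda>n i. \<kappa> i * hdiff (n - i)", OF hdiff_shift_summable[of k] s C]
  have inner: "infsum (\<lambda>n. hdiff (n + k) * (\<kappa> i * hdiff (n - i))) UNIV = - (\<kappa> i * (4 / (pi * (4 * of_int (i + k) ^ 2 - 1))))" for i
  proof -
    have "infsum (\<lambda>n. hdiff (n + k) * (\<kappa> i * hdiff (n - i))) UNIV
       = infsum (\<lambda>l. \<kappa> i * (hdiff l * hdiff (l + (i + k)))) UNIV"
      by (subst infsum_int_shift[of _ i, symmetric]) (simp add: algebra_simps)
    also have "\<dots> = \<kappa> i * (4 / (pi * (1 - 4 * of_int (i + k) ^ 2)))"
      by (simp only: infsum_cmult_right' infsumI[OF hdiff_corr])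
    also have "4 / (pi * (1 - 4 * real_of_int (i + k) ^ 2)) = - (4 / (pi * (4 * of_int (i + k) ^ 2 - 1)))"
      by (simp only: minus_divide_right mult_minus_right[symmetric] minus_diff_eq)
    finally show ?thesis by simp
  qed
  have "\<xi> (- k) = infsum (\<lambda>n. hdiff (n + k) * infsum (\<lambda>i. \<kappa> i * hdiff (n - i)) UNIV) UNIV"
    using infsumI[OF \<xi>_minus_has_sum[of k]] by (simp only: \<rho>_conv)
  with swap have "((\<lambda>i. - (\<kappa> i * (4 / (pi * (4 * of_int (i + k) ^ 2 - 1))))) has_sum \<xi> (- k)) UNIV"
    unfolding inner by (simp only: summable_iff_has_sum_infsum)
  then have "((\<lambda>i. \<kappa> i * (4 / (pi * (4 * of_int (i + k) ^ 2 - 1)))) has_sum - \<xi> (- k)) UNIV"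
    by (subst (asm) has_sum_uminus)
  then show ?thesis
    by (rule has_sum_cong_neutral[THEN iffD1, rotated -1]) (auto simp: \<kappa>_nonpos)
qed

text \<open>\<open>skernel\<close> is odd in its first argument, so only the odd part of
  \<open>\<xi>\<close> enters: this is how the imaginary part of \<open>F\<close> on the circle
  determines \<open>K\<close>.\<close>

lemma \<kappa>_fold:
  assumes "n \<ge> 0"
  shows "((\<lambda>j. (\<xi> j - \<xi> (- j)) * skernel j n) has_sum \<kappa> n) {1..}"
  using has_sum_int_fold[OF \<kappa>_has_sum[OF assms]] by (simp add: skernel_minus algebra_simps)

lemma \<xi>_diff_summable: "(\<lambda>j. \<xi> j - \<xi> (- j)) summable_on {1..}"
proof -
  have "(\<lambda>j. \<xi> (0 - j)) summable_on UNIV"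
    using summable_int_reflect[of \<xi> 0] \<xi>_summable by blast
  then obtain a b where "(\<xi> has_sum a) UNIV" "((\<lambda>j. \<xi> (0 - j)) has_sum b) UNIV"
    using \<xi>_summable by (auto simp: summable_on_def)
  then have "((\<lambda>j. \<xi> j - \<xi> (0 - j)) has_sum (a - b)) UNIV" by (rule has_sum_diff_real)
  then have "(\<lambda>j. \<xi> j - \<xi> (0 - j)) summable_on UNIV" by (auto simp: summable_on_def)
  then show ?thesis using summable_on_subset[of _ UNIV "{1..}"] by simp
qed


definition \<delta> :: "int \<Rightarrow> real" where
  "\<delta> j = \<nu> (j - 1) - \<nu> (- j - 1)"

text \<open>\<open>\<kappa>_fold\<close> is inserted into \<open>\<xi>_minus_\<kappa>\<close> and
  the sums are exchanged. For \<open>j \<ge> 1\<close> the odd part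
  \<open>\<xi> j - \<xi> (- j)\<close> equals \<open>[j = 1] - \<delta> j\<close>, whose bracket
  produces \<open>tkernel 1 k\<close>.\<close>

lemma \<delta>_tkernel_has_sum:
  assumes k: "k \<ge> 1"
  shows "((\<lambda>j. \<delta> j * tkernel j k) has_sum (tkernel 1 k - \<nu> (- k - 1))) {1..}"
proof -
  let ?u = "\<lambda>j. \<xi> j - \<xi> (- j)"
  have C: "infsum (\<lambda>i. \<bar>tterm j k i\<bar>) {1..} \<le> 4 / pi ^ 2 * (oddharm k + 1)" if "j \<in> {1..}" for j
  proof -
    have "infsum (\<lambda>i. \<bar>tterm j k i\<bar>) {1..} = tkernel j k"
      unfolding tkernel_def by (rule infsum_cong) (use that k tterm_nonneg in auto)
    then show ?thesis using tkernel_le that k by simp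
  qed
  have s: "tterm j k summable_on {1..}" if "j \<in> {1..}" for j using that k tterm_summable by simp
  have "infsum (\<lambda>j. ?u j * tkernel j k) {1..} = infsum (\<lambda>i. infsum (\<lambda>j. ?u j * tterm j k i) {1..}) {1..}"
    unfolding tkernel_def by (rule infsum_swap_bounded(1)[OF \<xi>_diff_summable s C])
  also have "\<dots> = infsum (\<lambda>i. \<kappa> i * (4 / (pi * (4 * of_int (i + k) ^ 2 - 1)))) {1..}"
  proof (rule infsum_cong)
    fix i :: int assume "i \<in> {1..}"
    then have "((\<lambda>j. ?u j * skernel j i * (4 / (pi * (4 * of_int (i + k) ^ 2 - 1)))) has_sum
        \<kappa> i * (4 / (pi * (4 * of_int (i + k) ^ 2 - 1)))) {1..}"
      by (intro has_sum_cmult_left \<kappa>_fold) simp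
    then show "infsum (\<lambda>j. ?u j * tterm j k i) {1..} = \<kappa> i * (4 / (pi * (4 * of_int (i + k) ^ 2 - 1)))"
      by (intro infsumI) (simp only: tterm_def mult.assoc)
  qed
  also have "\<dots> = \<nu> (- k - 1)"
    using infsumI[OF \<xi>_minus_\<kappa>] \<xi>_minus[of k] k by simp
  finally have i: "infsum (\<lambda>j. ?u j * tkernel j k) {1..} = \<nu> (- k - 1)" .
  have "(\<lambda>j. ?u j * tkernel j k) summable_on {1..}"
  proof (rule summable_on_mult_bounded[OF \<xi>_diff_summable])
    fix j :: int assume "j \<in> {1..}"
    then show "\<bar>tkernel j k\<bar> \<le> 4 / pi ^ 2 * (oddharm k + 1)"
      using tkernel_le[of j k] tkernel_nonneg[of j k] k by simp
  qed
  then have "((\<lambda>j. ?u j * tkernel j k) has_sum \<nu> (- k - 1)) {1..}"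
    using i has_sum_infsum by metis
  moreover have "((\<lambda>j. if j = 1 then tkernel j k else 0) has_sum tkernel 1 k) {1..}"
    by (rule has_sum_finite_neutralI[of "{1}"]) auto
  ultimately have "((\<lambda>j. (if j = 1 then tkernel j k else 0) - ?u j * tkernel j k) has_sum (tkernel 1 k - \<nu> (- k - 1))) {1..}"
    by (intro has_sum_diff_real)
  then show ?thesis
    by (rule has_sum_cong[THEN iffD1, rotated]) (auto simp: \<delta>_def \<xi>_def algebra_simps)
qed

text \<open>The factor \<open>j\<close> is taken out of the kernel, leaving \<open>mkernel\<close>
  with leading growth independent of \<open>j\<close>. The total mass of \<open>\<mu>\<close>
  separates the two regimes.\<close>

definition \<mu> :: "int \<Rightarrow> real" where
  "\<mu> j = of_int j * \<delta> j"

lemma \<mu>_mkernel_has_sum: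
  assumes k: "k \<ge> 1"
  shows "((\<lambda>j. \<mu> j * mkernel j k) has_sum (mkernel 1 k - pi ^ 2 / 4 * of_int k ^ 2 * \<nu> (- k - 1))) {1..}"
proof -
  have "((\<lambda>j. pi ^ 2 / 4 * of_int k ^ 2 * (\<delta> j * tkernel j k)) has_sum
     pi ^ 2 / 4 * of_int k ^ 2 * (tkernel 1 k - \<nu> (- k - 1))) {1..}"
    by (intro has_sum_cmult_right \<delta>_tkernel_has_sum k)
  then have "((\<lambda>j. \<mu> j * mkernel j k) has_sum pi ^ 2 / 4 * of_int k ^ 2 * (tkernel 1 k - \<nu> (- k - 1))) {1..}"
    by (rule has_sum_cong[THEN iffD1, rotated]) (simp add: \<mu>_def mkernel_def)
  moreover have "pi ^ 2 / 4 * of_int k ^ 2 * (tkernel 1 k - \<nu> (- k - 1)) = mkernel 1 k - pi ^ 2 / 4 * of_int k ^ 2 * \<nu> (- k - 1)"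
    by (simp add: mkernel_def right_diff_distrib)
  ultimately show ?thesis by (simp only:)
qed

end

section \<open>Asymptotics\<close>

text \<open>The terms of \<open>harm (2 * k)\<close> with even denominator add up to
  \<open>harm k / 2\<close>.\<close>

lemma oddharm_harm: "oddharm (int k) = harm (2 * k) - harm k / 2"
proof (induction k)
  case (Suc k)
  have "oddharm (int (Suc k)) = oddharm (int k) + 1 / (2 * real k + 1)"
    using oddharm_step[of "int k"] by (simp add: add.commute)
  moreover have "harm (2 * Suc k) = harm (2 * k) + 1 / (2 * real k + 1) + (1 / (real k + 1)) / (2 :: real)"
    by (simp add: harm_Suc field_simps)
  moreover have "harm (Suc k) = harm k + 1 / (real k + 1)"
    by (simp add: harm_Suc field_simps)
  ultimately show ?case by (simp add: Suc.IH add_divide_distrib)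
qed (simp add: harm_expand)

lemma oddharm_over_ln: "(\<lambda>k. oddharm (int k) / ln (real k)) \<longlonglongrightarrow> 1 / 2"
proof -
  have 1: "(\<lambda>n. harm n - ln (real n)) \<longlonglongrightarrow> euler_mascheroni"
    by (rule euler_mascheroni_LIMSEQ)
  have 2: "(\<lambda>n. harm (2 * n) - ln (real (2 * n))) \<longlonglongrightarrow> euler_mascheroni"
    by (rule LIMSEQ_subseq_LIMSEQ[OF 1, of "\<lambda>n. 2 * n", unfolded o_def]) (simp add: strict_mono_def)
  have 3: "(\<lambda>n. (harm (2 * n) - ln (real (2 * n))) - (harm n - ln (real n)) / 2) \<longlonglongrightarrow> euler_mascheroni - euler_mascheroni / 2"
    by (intro tendsto_intros 1 2) simp
  have 4: "(\<lambda>n. inverse (ln (real n))) \<longlonglongrightarrow> 0" by real_asymp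
  have 5: "(\<lambda>n. ln (real (2 * n)) / ln (real n)) \<longlonglongrightarrow> 1" by real_asymp
  have "(\<lambda>n. inverse (ln (real n)) * ((harm (2 * n) - ln (real (2 * n))) - (harm n - ln (real n)) / 2)
      + ln (real (2 * n)) / ln (real n) - 1 / 2) \<longlonglongrightarrow> 0 * (euler_mascheroni - euler_mascheroni / 2) + 1 - 1 / 2"
    by (intro tendsto_diff tendsto_add tendsto_mult tendsto_const 3 4 5)
  moreover have "\<forall>\<^sub>F n in sequentially. inverse (ln (real n)) * ((harm (2 * n) - ln (real (2 * n))) - (harm n - ln (real n)) / 2)
      + ln (real (2 * n)) / ln (real n) - 1 / 2 = oddharm (int n) / ln (real n)"
    using eventually_gt_at_top[of 1]
  proof eventually_elim
    case (elim n)
    then have "ln (real n) > 0" by simp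
    then show ?case by (simp add: oddharm_harm field_simps)
  qed
  ultimately show ?thesis by (simp add: Lim_transform_eventually)
qed

lemma oddharm_at_top: "filterlim (\<lambda>k. oddharm (int k)) at_top sequentially"
proof -
  have "filterlim (\<lambda>k. oddharm (int k) / ln (real k) * ln (real k)) at_top sequentially"
  proof (rule filterlim_tendsto_pos_mult_at_top[OF oddharm_over_ln])
    show "filterlim (\<lambda>k. ln (real k)) at_top sequentially" by real_asymp
  qed simp
  moreover have "\<forall>\<^sub>F k in sequentially. oddharm (int k) / ln (real k) * ln (real k) = oddharm (int k)"
    using eventually_gt_at_top[of 1] by eventually_elim simp
  ultimately show ?thesis by (subst (asm) filterlim_cong[OF refl refl])
qed

lemma oddharm_ge_1: "k \<ge> 1 \<Longrightarrow> oddharm k \<ge> 1"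
proof -
  assume "k \<ge> 1"
  then have "oddharm 1 \<le> oddharm k" by (intro oddharm_mono_abs) simp
  then show ?thesis by (simp add: oddharm_def)
qed

lemma oddharm_1 [simp]: "oddharm 1 = 1"
  by (simp add: oddharm_def)

lemma bounded_over_oddharm:
  assumes "\<forall>\<^sub>F k in sequentially. \<bar>f k\<bar> \<le> C"
  shows "(\<lambda>k. f k / oddharm (int k)) \<longlonglongrightarrow> 0"
proof (rule Lim_null_comparison)
  show "(\<lambda>k. C / oddharm (int k)) \<longlonglongrightarrow> 0"
    using tendsto_mult[OF tendsto_const[of C] tendsto_inverse_0_at_top[OF oddharm_at_top]] by (simp add: divide_inverse)
  show "\<forall>\<^sub>F k in sequentially. norm (f k / oddharm (int k)) \<le> C / oddharm (int k)"
    using assms by eventually_elim (simp add: oddharm_nonneg divide_right_mono)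
qed

text \<open>Dominated convergence along an arbitrary filter: a finite set carries all but a small
  part of the mass of \<open>\<mu>\<close>, and the rest is controlled by the uniform bound.\<close>

lemma dominated_infsum_tendsto_0:
  fixes \<mu> :: "'a \<Rightarrow> real" and f :: "'b \<Rightarrow> 'a \<Rightarrow> real"
  assumes \<mu>: "\<mu> summable_on A" and nonneg: "\<And>j. j \<in> A \<Longrightarrow> \<mu> j \<ge> 0"
    and bd: "\<forall>\<^sub>F k in F. \<forall>j\<in>A. \<bar>f k j\<bar> \<le> C"
    and lim: "\<And>j. j \<in> A \<Longrightarrow> ((\<lambda>k. f k j) \<longlongrightarrow> 0) F"
  shows "((\<lambda>k. infsum (\<lambda>j. \<mu> j * f k j) A) \<longlongrightarrow> 0) F"
proof (rule tendstoI)
  fix e :: real assume e: "e > 0"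
  \<comment> \<open>Positive even when \<open>C \<le> 0\<close>, so that dividing by it is
    safe.\<close>
  define C' where "C' = max C 0 + 1"
  have C': "C' > 0" "C \<le> C'" by (auto simp: C'_def)
  obtain B where B: "finite B" "B \<subseteq> A" "dist (sum \<mu> B) (infsum \<mu> A) \<le> e / (4 * C')"
    using infsum_finite_approximation[OF \<mu>, of "e / (4 * C')"] e C' by auto
  have sB: "\<mu> summable_on B" "\<mu> summable_on (A - B)"
    using summable_on_subset[OF \<mu>] B by auto
  have split: "infsum g A = sum g B + infsum g (A - B)" if "g summable_on A" for g :: "'a \<Rightarrow> real"
  proof -
    have "infsum g (B \<union> (A - B)) = infsum g B + infsum g (A - B)"
      by (intro infsum_Un_disjoint summable_on_subset[OF that]) (use B in auto)
    moreover have "B \<union> (A - B) = A" using B by auto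
    ultimately show ?thesis using B by simp
  qed
  have tail: "infsum \<mu> (A - B) \<le> e / (4 * C')"
    using split[OF \<mu>] B(3) by (simp add: dist_real_def)
  have "((\<lambda>k. \<Sum>j\<in>B. \<mu> j * f k j) \<longlongrightarrow> (\<Sum>j\<in>B. \<mu> j * 0)) F"
    using B by (intro tendsto_intros lim) auto
  then have "\<forall>\<^sub>F k in F. dist (\<Sum>j\<in>B. \<mu> j * f k j) 0 < e / 2"
    using e by (intro tendstoD) simp_all
  with bd show "\<forall>\<^sub>F k in F. dist (infsum (\<lambda>j. \<mu> j * f k j) A) 0 < e"
  proof eventually_elim
    case (elim k)
    have s: "(\<lambda>j. \<mu> j * f k j) summable_on A"
      by (rule summable_on_mult_bounded[OF \<mu>, of _ C]) (use elim in auto)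
    have sAB: "(\<lambda>j. \<mu> j * f k j) summable_on (A - B)"
      by (rule summable_on_subset[OF s]) auto
    have "\<bar>infsum (\<lambda>j. \<mu> j * f k j) (A - B)\<bar> \<le> infsum (\<lambda>j. \<bar>\<mu> j * f k j\<bar>) (A - B)"
      using norm_infsum_bound[of "\<lambda>j. \<mu> j * f k j" "A - B"] summable_on_abs[OF sAB] by simp
    also have "\<dots> \<le> infsum (\<lambda>j. \<mu> j * C') (A - B)"
    proof (intro infsum_mono summable_on_abs sAB summable_on_cmult_left sB)
      fix j assume "j \<in> A - B"
      then have "\<mu> j * \<bar>f k j\<bar> \<le> \<mu> j * C'"
        using elim C' by (intro mult_left_mono nonneg) force+
      then show "\<bar>\<mu> j * f k j\<bar> \<le> \<mu> j * C'"
        using nonneg[of j] \<open>j \<in> A - B\<close> by (simp add: abs_mult)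
    qed
    also have "\<dots> = infsum \<mu> (A - B) * C'" by (rule infsum_cmult_left')
    also have "\<dots> \<le> e / (4 * C') * C'" using tail C' by (intro mult_right_mono) auto
    also have "\<dots> = e / 4" using C' by simp
    finally show ?case using elim e split[OF s] by (simp add: dist_real_def)
  qed
qed

text \<open>For fixed \<open>j\<close> the error \<open>D * j^2 / (k^2 - j^2)\<close> is at most
  \<open>j / k\<close>. Together with the uniform bound this makes the total error vanish when
  \<open>\<sigma> = 1\<close>.\<close>

lemma mkernel_limit:
  assumes "j \<ge> 1"
  shows "(\<lambda>k. mkernel j (int k) - (oddharm (int k) - oddharm (min j (int k)))) \<longlonglongrightarrow> 0"
proof (rule Lim_null_comparison)
  define J where "J = real_of_int j"
  have J: "J \<ge> 1" using assms by (simp add: J_def)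
  show "(\<lambda>k. J / real k) \<longlonglongrightarrow> 0" by real_asymp
  show "\<forall>\<^sub>F k in sequentially. norm (mkernel j (int k) - (oddharm (int k) - oddharm (min j (int k)))) \<le> J / real k"
    using eventually_gt_at_top[of "nat j"]
  proof eventually_elim
    case (elim k)
    define K D where "K = real k" and "D = oddharm (int k) - oddharm j"
    have jk: "j < int k" using elim assms by linarith
    have JK: "J < K" using jk by (simp add: J_def K_def)
    have D0: "D \<ge> 0" using jk assms by (auto simp: D_def intro!: oddharm_mono_abs)
    have D: "D \<le> (K - J) / (2 * J)" using oddharm_diff_le[of j "int k"] jk assms by (simp add: D_def J_def K_def)
    have pos: "K ^ 2 - J ^ 2 > 0" using JK J by (simp add: power_strict_mono)
    have m: "mkernel j (int k) - (oddharm (int k) - oddharm (min j (int k))) = D * J ^ 2 / (K ^ 2 - J ^ 2)"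
    proof -
      have "mkernel j (int k) = K ^ 2 * (D / (K ^ 2 - J ^ 2))"
        using mkernel_neq[of j "int k"] jk assms by (simp add: D_def J_def K_def)
      moreover have "oddharm (int k) - oddharm (min j (int k)) = D" using jk by (simp add: D_def)
      ultimately show ?thesis using pos by (simp add: field_simps)
    qed
    have "D * J ^ 2 \<le> (K - J) / (2 * J) * J ^ 2" by (intro mult_right_mono D) simp
    also have "\<dots> = (K - J) * (J / 2)" using J by (simp add: power2_eq_square)
    also have "\<dots> \<le> (K - J) * (J * (K + J) / K)"
    proof (intro mult_left_mono)
      have "J / 2 \<le> J * 1" using J by simp
      also have "\<dots> \<le> J * ((K + J) / K)" using J JK by (intro mult_left_mono) (auto simp: le_divide_eq)
      finally show "J / 2 \<le> J * (K + J) / K" by simp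
    qed (use JK in auto)
    also have "\<dots> = ((K - J) * (K + J)) * (J / K)" by simp
    also have "(K - J) * (K + J) = K ^ 2 - J ^ 2" by (simp add: power2_eq_square algebra_simps)
    finally have "D * J ^ 2 / (K ^ 2 - J ^ 2) \<le> J / K" using pos by (simp add: divide_le_eq mult.commute)
    moreover have "D * J ^ 2 / (K ^ 2 - J ^ 2) \<ge> 0" using pos D0 by simp
    ultimately show ?case unfolding m by (simp only: real_norm_def abs_of_nonneg K_def[symmetric])
  qed
qed

text \<open>By monotonicity \<open>oddharm (min j a)\<close> is the minimum of
  \<open>oddharm j\<close> and \<open>oddharm a\<close>, and taking the minimum with a constant is a
  contraction.\<close>

lemma clamp_diff_le:
  assumes "1 \<le> j" "1 \<le> a" "1 \<le> b"
  shows "\<bar>oddharm (min j a) - oddharm (min j b)\<bar> \<le> \<bar>oddharm a - oddharm b\<bar>"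
proof -
  have m: "oddharm p \<le> oddharm q" if "1 \<le> p" "p \<le> q" for p q
    using that by (intro oddharm_mono_abs) auto
  consider "a \<le> b" "j \<le> a" | "a \<le> b" "a \<le> j" "j \<le> b" | "b \<le> j" "a \<le> b"
    | "b \<le> a" "j \<le> b" | "b \<le> a" "b \<le> j" "j \<le> a" | "a \<le> j" "b \<le> a" by linarith
  then show ?thesis
    by cases (use m[of a j] m[of b j] m[of j a] m[of j b] m[of a b] m[of b a] assms in \<open>auto simp: min_def abs_if\<close>)
qed

lemma mkernel_over_oddharm:
  assumes "j \<ge> 1"
  shows "(\<lambda>k. mkernel j (int k) / oddharm (int k)) \<longlonglongrightarrow> 1"
proof -
  have "(\<lambda>k. (mkernel j (int k) - oddharm (int k)) / oddharm (int k)) \<longlonglongrightarrow> 0"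
  proof (rule bounded_over_oddharm)
    show "\<forall>\<^sub>F k in sequentially. \<bar>mkernel j (int k) - oddharm (int k)\<bar> \<le> 1 + oddharm j"
      using eventually_ge_at_top[of 1]
    proof eventually_elim
      case (elim k)
      have "oddharm (min j (int k)) \<le> oddharm j" using elim assms by (intro oddharm_mono_abs) auto
      then show ?case
        using mkernel_bound[of j "int k"] oddharm_nonneg[of "min j (int k)"] assms elim by (simp add: abs_le_iff)
    qed
  qed
  from tendsto_add[OF this tendsto_const[of 1]]
  have "(\<lambda>k. (mkernel j (int k) - oddharm (int k)) / oddharm (int k) + 1) \<longlonglongrightarrow> 1" by simp
  moreover have "\<forall>\<^sub>F k in sequentially. (mkernel j (int k) - oddharm (int k)) / oddharm (int k) + 1 = mkernel j (int k) / oddharm (int k)"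
    using eventually_ge_at_top[of 1]
  proof eventually_elim
    case (elim k)
    then show ?case using oddharm_ge_1[of "int k"] by (simp add: field_simps)
  qed
  ultimately show ?thesis by (simp add: Lim_transform_eventually)
qed

lemma oddharm_clamp_ge_1: "j \<ge> 1 \<Longrightarrow> a \<ge> 1 \<Longrightarrow> oddharm (min j a) \<ge> 1"
  by (intro oddharm_ge_1) simp

lemma filterlim_floor: "filterlim (\<lambda>y::real. \<lfloor>c * y\<rfloor>) at_top at_top" if "c > 0" for c
proof -
  have "filterlim (\<lambda>y. c * y) at_top at_top"
    using that by (rule filterlim_tendsto_pos_mult_at_top[OF tendsto_const _ filterlim_ident])
  from filterlim_compose[OF filterlim_floor_sequentially this] show ?thesis by simp
qed

lemma ratio_tendsto_1:
  fixes f g :: "'b \<Rightarrow> real"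
  assumes "((\<lambda>k. f k - g k) \<longlongrightarrow> 0) F" "c > 0" "\<forall>\<^sub>F k in F. g k \<ge> c"
  shows "((\<lambda>k. f k / g k) \<longlongrightarrow> 1) F"
proof -
  have "((\<lambda>k. (f k - g k) / g k) \<longlongrightarrow> 0) F"
  proof (rule Lim_null_comparison)
    show "((\<lambda>k. \<bar>f k - g k\<bar> / c) \<longlongrightarrow> 0) F"
      using tendsto_divide[OF tendsto_rabs[OF assms(1)] tendsto_const[of c]] assms(2) by simp
    show "\<forall>\<^sub>F k in F. norm ((f k - g k) / g k) \<le> \<bar>f k - g k\<bar> / c"
      using assms(3) by eventually_elim (use assms(2) in \<open>auto intro!: divide_left_mono\<close>)
  qed
  from tendsto_add[OF this tendsto_const[of 1]]
  have "((\<lambda>k. (f k - g k) / g k + 1) \<longlongrightarrow> 1) F" by simp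
  moreover have "\<forall>\<^sub>F k in F. (f k - g k) / g k + 1 = f k / g k"
    using assms(3) by eventually_elim (use assms(2) in \<open>simp add: diff_divide_distrib\<close>)
  ultimately show ?thesis by (rule Lim_transform_eventually)
qed

text \<open>A cutoff beyond \<open>j\<close> is invisible to the \<open>j\<close>-th term, so every
  term is eventually 0, and the bounded gap dominates. It makes \<open>L\<close> insensitive to
  rescaling and to unit shifts.\<close>

lemma clamp_sum_tendsto_0:
  fixes \<mu> :: "int \<Rightarrow> real"
  assumes \<mu>: "\<mu> summable_on {1..}" and nonneg: "\<And>j. j \<ge> 1 \<Longrightarrow> \<mu> j \<ge> 0"
    and a: "filterlim a at_top F" and b: "filterlim b at_top F"
    and bd: "\<forall>\<^sub>F k in F. \<bar>oddharm (a k) - oddharm (b k)\<bar> \<le> C"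
  shows "((\<lambda>k. infsum (\<lambda>j. \<mu> j * (oddharm (min j (a k)) - oddharm (min j (b k)))) {1..}) \<longlongrightarrow> 0) F"
proof (rule dominated_infsum_tendsto_0[OF \<mu>, where C=C])
  have "\<forall>\<^sub>F k in F. 1 \<le> a k" "\<forall>\<^sub>F k in F. 1 \<le> b k"
    using a b by (simp_all add: filterlim_at_top)
  with bd show "\<forall>\<^sub>F k in F. \<forall>j\<in>{1..}. \<bar>oddharm (min j (a k)) - oddharm (min j (b k))\<bar> \<le> C"
  proof (eventually_elim, intro ballI)
    fix k and j :: int assume "\<bar>oddharm (a k) - oddharm (b k)\<bar> \<le> C" "1 \<le> a k" "1 \<le> b k" "j \<in> {1..}"
    then show "\<bar>oddharm (min j (a k)) - oddharm (min j (b k))\<bar> \<le> C"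
      using clamp_diff_le[of j "a k" "b k"] by simp
  qed
  fix j :: int assume "j \<in> {1..}"
  have "\<forall>\<^sub>F k in F. j \<le> a k" "\<forall>\<^sub>F k in F. j \<le> b k"
    using a b by (simp_all add: filterlim_at_top)
  then have "\<forall>\<^sub>F k in F. oddharm (min j (a k)) - oddharm (min j (b k)) = 0"
    by eventually_elim simp
  then show "((\<lambda>k. oddharm (min j (a k)) - oddharm (min j (b k))) \<longlongrightarrow> 0) F"
    by (rule tendsto_eventually)
qed (use nonneg in auto)

lemma mkernel_nonneg: "j \<ge> 1 \<Longrightarrow> k \<ge> 1 \<Longrightarrow> mkernel j k \<ge> 0"
  unfolding mkernel_def using tkernel_nonneg[of j k] by simp

lemma mkernel_le:
  assumes "j \<ge> 1" "k \<ge> 1"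
  shows "\<bar>mkernel j k\<bar> \<le> 1 + oddharm k"
  using mkernel_bound[OF assms] oddharm_nonneg[of "min j k"] mkernel_nonneg[OF assms] by linarith

section \<open>Nonnegative weights and their total mass \<open>\<sigma>\<close>\<close>

locale hdown_harmonic_dominated = hdown_harmonic +
  assumes dom: "\<And>k::int. k \<ge> 1 \<Longrightarrow> \<nu> (k - 1) \<ge> \<nu> (- k - 1)"
begin

lemma \<mu>_nonneg: "j \<ge> 1 \<Longrightarrow> \<mu> j \<ge> 0"
  using dom[of j] by (simp add: \<mu>_def \<delta>_def)

text \<open>Fatou: all terms of the representation are nonnegative, so a finite part of the sum is
  at most \<open>mkernel 1 k\<close>; after division by \<open>oddharm k\<close> every kernel tends
  to 1.\<close>

lemma \<mu>_sum_le_1: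
  assumes F: "finite F" "F \<subseteq> {1..}"
  shows "sum \<mu> F \<le> 1"
proof -
  have "(\<lambda>k. \<Sum>j\<in>F. \<mu> j * (mkernel j (int k) / oddharm (int k))) \<longlonglongrightarrow> (\<Sum>j\<in>F. \<mu> j * 1)"
    by (intro tendsto_intros mkernel_over_oddharm) (use F in auto)
  moreover have "(\<lambda>k. mkernel 1 (int k) / oddharm (int k)) \<longlonglongrightarrow> 1"
    by (rule mkernel_over_oddharm) simp
  moreover have "(\<Sum>j\<in>F. \<mu> j * (mkernel j (int k) / oddharm (int k))) \<le> mkernel 1 (int k) / oddharm (int k)" if "k \<ge> 1" for k
  proof -
    have "(\<Sum>j\<in>F. \<mu> j * mkernel j (int k)) \<le> mkernel 1 (int k) - pi ^ 2 / 4 * of_int (int k) ^ 2 * \<nu> (- int k - 1)"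
      by (rule finite_sum_le_has_sum[OF \<mu>_mkernel_has_sum]) (use that F in \<open>auto intro!: mult_nonneg_nonneg \<mu>_nonneg mkernel_nonneg\<close>)
    also have "\<dots> \<le> mkernel 1 (int k)" using nonneg[of "- int k - 1"] by simp
    finally have "(\<Sum>j\<in>F. \<mu> j * mkernel j (int k)) / oddharm (int k) \<le> mkernel 1 (int k) / oddharm (int k)"
      by (rule divide_right_mono) (rule oddharm_nonneg)
    then show ?thesis by (simp add: sum_divide_distrib)
  qed
  ultimately show ?thesis by (intro LIMSEQ_le) (auto intro!: exI[of _ 1])
qed

lemma \<mu>_summable: "\<mu> summable_on {1..}"
  by (intro nonneg_bdd_above_summable_on bdd_aboveI[of _ 1]) (use \<mu>_nonneg \<mu>_sum_le_1 in auto)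

definition \<sigma> :: real where
  "\<sigma> = infsum \<mu> {1..}"

lemma \<mu>_has_sum: "(\<mu> has_sum \<sigma>) {1..}"
  using \<mu>_summable by (simp add: \<sigma>_def)

lemma \<sigma>_bounds: "0 \<le> \<sigma>" "\<sigma> \<le> 1"
  unfolding \<sigma>_def using \<mu>_nonneg \<mu>_sum_le_1
  by (auto intro!: infsum_nonneg infsum_le_finite_sums[OF \<mu>_summable])

text \<open>The representation divided by \<open>oddharm k\<close>: each normalised kernel tends to
  1 and is at most 2, whence the dominating constant 3 for its distance to 1.\<close>

lemma \<nu>_over_oddharm:
  "(\<lambda>k. pi ^ 2 / 4 * real k ^ 2 * \<nu> (- int k - 1) / oddharm (int k)) \<longlonglongrightarrow> 1 - \<sigma>"
proof -
  have "(\<lambda>k. infsum (\<lambda>j. \<mu> j * (mkernel j (int k) / oddharm (int k) - 1)) {1..}) \<longlonglongrightarrow> 0"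
  proof (rule dominated_infsum_tendsto_0[OF \<mu>_summable, where C=3])
    show "\<forall>\<^sub>F k in sequentially. \<forall>j\<in>{1..}. \<bar>mkernel j (int k) / oddharm (int k) - 1\<bar> \<le> 3"
      using eventually_ge_at_top[of 1]
    proof (eventually_elim, intro ballI)
      fix k :: nat and j :: int assume k: "1 \<le> k" and j: "j \<in> {1..}"
      have o: "oddharm (int k) \<ge> 1" using k by (intro oddharm_ge_1) simp
      have "\<bar>mkernel j (int k)\<bar> \<le> 2 * oddharm (int k)" using mkernel_le[of j "int k"] j k o by simp
      then have "\<bar>mkernel j (int k) / oddharm (int k)\<bar> \<le> 2" using o by (simp add: divide_le_eq)
      then show "\<bar>mkernel j (int k) / oddharm (int k) - 1\<bar> \<le> 3" by linarith
    qed
    show "(\<lambda>k. mkernel j (int k) / oddharm (int k) - 1) \<longlonglongrightarrow> 0" if "j \<in> {1..}" for j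
      using tendsto_diff[OF mkernel_over_oddharm[of j] tendsto_const[of 1]] that by simp
  qed (use \<mu>_nonneg in auto)
  from tendsto_diff[OF mkernel_over_oddharm[of 1] tendsto_add[OF this tendsto_const[of \<sigma>]]]
  have l: "(\<lambda>k. mkernel 1 (int k) / oddharm (int k) - (infsum (\<lambda>j. \<mu> j * (mkernel j (int k) / oddharm (int k) - 1)) {1..} + \<sigma>)) \<longlonglongrightarrow> 1 - \<sigma>"
    by simp
  moreover have "\<forall>\<^sub>F k in sequentially. mkernel 1 (int k) / oddharm (int k) - (infsum (\<lambda>j. \<mu> j * (mkernel j (int k) / oddharm (int k) - 1)) {1..} + \<sigma>)
     = pi ^ 2 / 4 * real k ^ 2 * \<nu> (- int k - 1) / oddharm (int k)"
    using eventually_ge_at_top[of 1]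
  proof eventually_elim
    case (elim k)
    have "((\<lambda>j. \<mu> j * mkernel j (int k) * (1 / oddharm (int k)) - \<mu> j) has_sum
       ((mkernel 1 (int k) - pi ^ 2 / 4 * of_int (int k) ^ 2 * \<nu> (- int k - 1)) * (1 / oddharm (int k)) - \<sigma>)) {1..}"
      by (intro has_sum_diff_real has_sum_cmult_left \<mu>_mkernel_has_sum \<mu>_has_sum) (use elim in simp)
    then have "((\<lambda>j. \<mu> j * (mkernel j (int k) / oddharm (int k) - 1)) has_sum
       ((mkernel 1 (int k) - pi ^ 2 / 4 * of_int (int k) ^ 2 * \<nu> (- int k - 1)) * (1 / oddharm (int k)) - \<sigma>)) {1..}"
      by (rule has_sum_cong[THEN iffD1, rotated]) (simp add: right_diff_distrib)
    from infsumI[OF this] show ?case by (simp add: diff_divide_distrib)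
  qed
  ultimately show ?thesis by (rule Lim_transform_eventually)
qed

text \<open>The constant is \<open>4 / pi^2\<close> from the representation times
  \<open>1 / 2\<close> from the growth \<open>ln k / 2\<close> of \<open>oddharm k\<close>. The
  representation concerns \<open>\<nu> (- k - 1)\<close>, hence the correction factors with
  \<open>Suc k\<close>.\<close>

lemma case_less_1:
  assumes "\<sigma> < 1"
  shows "(\<lambda>k::nat. \<nu> (- int k)) \<sim>[at_top] (\<lambda>k. (2 / pi ^ 2 * (1 - \<sigma>)) * ln (real k) / (real k)^2)"
proof (rule asymp_equivI')
  have c: "2 / pi ^ 2 * (1 - \<sigma>) \<noteq> 0" using assms by simp
  have 1: "(\<lambda>k. ln (real k) / ln (real (Suc k)) * (real (Suc k) ^ 2 / real k ^ 2)) \<longlonglongrightarrow> 1" by real_asymp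
  have "(\<lambda>k. 2 / (1 - \<sigma>) * (pi ^ 2 / 4 * real k ^ 2 * \<nu> (- int k - 1) / oddharm (int k)) * (oddharm (int k) / ln (real k))
     * (ln (real k) / ln (real (Suc k)) * (real (Suc k) ^ 2 / real k ^ 2))) \<longlonglongrightarrow> 2 / (1 - \<sigma>) * (1 - \<sigma>) * (1 / 2) * 1"
    by (intro tendsto_mult tendsto_const \<nu>_over_oddharm oddharm_over_ln 1)
  moreover have "2 / (1 - \<sigma>) * (1 - \<sigma>) * (1 / 2) * 1 = (1 :: real)" using assms by simp
  moreover have "\<forall>\<^sub>F k in sequentially. 2 / (1 - \<sigma>) * (pi ^ 2 / 4 * real k ^ 2 * \<nu> (- int k - 1) / oddharm (int k)) * (oddharm (int k) / ln (real k))
     * (ln (real k) / ln (real (Suc k)) * (real (Suc k) ^ 2 / real k ^ 2))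
     = \<nu> (- int (Suc k)) / ((2 / pi ^ 2 * (1 - \<sigma>)) * ln (real (Suc k)) / (real (Suc k))^2)"
    using eventually_gt_at_top[of 1]
  proof eventually_elim
    case (elim k)
    have o: "oddharm (int k) \<ge> 1" using elim by (intro oddharm_ge_1) simp
    have l: "ln (real k) > 0" "ln (real (Suc k)) > 0" using elim by simp_all
    have e: "- int (Suc k) = - int k - 1" by simp
    have "2 / t * (p / 4 * K * n / q) * (q / m) * (m / m' * (K' / K)) = n / ((2 / p * t) * m' / K')"
      if "t \<noteq> 0" "p \<noteq> 0" "K \<noteq> 0" "q \<noteq> 0" "m \<noteq> 0" "m' \<noteq> 0" "K' \<noteq> 0" for t p K n q m m' K' :: real
      using that by (simp add: field_simps)
    from this[of "1 - \<sigma>" "pi ^ 2" "real k ^ 2" "oddharm (int k)" "ln (real k)" "ln (real (Suc k))" "real (Suc k) ^ 2" "\<nu> (- int k - 1)"]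
    show ?case unfolding e using o l elim assms by simp
  qed
  ultimately have "(\<lambda>k. \<nu> (- int (Suc k)) / ((2 / pi ^ 2 * (1 - \<sigma>)) * ln (real (Suc k)) / (real (Suc k))^2)) \<longlonglongrightarrow> 1"
    by (simp only: Lim_transform_eventually)
  then show "(\<lambda>k. \<nu> (- int k) / ((2 / pi ^ 2 * (1 - \<sigma>)) * ln (real k) / (real k)^2)) \<longlonglongrightarrow> 1"
    by (rule LIMSEQ_imp_Suc)
qed

section \<open>The critical case and the truncated mean \<open>L\<close>\<close>

text \<open>The subtracted 1 is \<open>oddharm 1\<close>, left over from \<open>mkernel 1 k\<close>;
  the floor extends the function to real arguments.\<close>

definition L :: "real \<Rightarrow> real" where
  "L y = 4 / pi ^ 2 * infsum (\<lambda>j. \<mu> j * (oddharm (min j \<lfloor>y\<rfloor>) - 1)) {1..}"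

lemma L_summable: "(\<lambda>j. \<mu> j * (oddharm (min j a) - 1)) summable_on {1..}"
proof (rule summable_on_mult_bounded[OF \<mu>_summable])
  fix j :: int assume j: "j \<in> {1..}"
  then have "oddharm (min j a) \<le> oddharm a" by (intro oddharm_mono_abs) auto
  then show "\<bar>oddharm (min j a) - 1\<bar> \<le> 1 + oddharm a"
    using oddharm_nonneg[of "min j a"] by linarith
qed

lemma L_diff:
  "L y - L z = 4 / pi ^ 2 * infsum (\<lambda>j. \<mu> j * (oddharm (min j \<lfloor>y\<rfloor>) - oddharm (min j \<lfloor>z\<rfloor>))) {1..}"
proof -
  have "((\<lambda>j. \<mu> j * (oddharm (min j \<lfloor>y\<rfloor>) - 1) - \<mu> j * (oddharm (min j \<lfloor>z\<rfloor>) - 1)) has_sum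
     (infsum (\<lambda>j. \<mu> j * (oddharm (min j \<lfloor>y\<rfloor>) - 1)) {1..} - infsum (\<lambda>j. \<mu> j * (oddharm (min j \<lfloor>z\<rfloor>) - 1)) {1..})) {1..}"
    by (intro has_sum_diff_real has_sum_infsum L_summable)
  from infsumI[OF this] show ?thesis by (simp add: L_def right_diff_distrib)
qed

lemma L_diff_tendsto_0:
  assumes "filterlim (\<lambda>k. \<lfloor>a k\<rfloor>) at_top F" "filterlim (\<lambda>k. \<lfloor>b k\<rfloor>) at_top F"
    and "\<forall>\<^sub>F k in F. \<bar>oddharm \<lfloor>a k\<rfloor> - oddharm \<lfloor>b k\<rfloor>\<bar> \<le> C"
  shows "((\<lambda>k. L (a k) - L (b k)) \<longlongrightarrow> 0) F"
  unfolding L_diff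
  using tendsto_mult[OF tendsto_const clamp_sum_tendsto_0[OF \<mu>_summable \<mu>_nonneg assms], of "4 / pi ^ 2"] by simp

text \<open>All terms are nonnegative, and the \<open>j\<close>-th alone contributes at least
  \<open>oddharm 2 - 1 = 1 / 3\<close> times its weight; a single \<open>j \<ge> 2\<close> with
  positive weight keeps \<open>L\<close> away from 0.\<close>

lemma L_lower:
  assumes "j \<ge> 2" "y \<ge> 2"
  shows "4 / pi ^ 2 * (\<mu> j * (1 / 3)) \<le> L y"
proof -
  have y: "\<lfloor>y\<rfloor> \<ge> 2" using assms by linarith
  have "oddharm 2 = 1 + 1 / 3" using oddharm_step[of 1] by simp
  moreover have "oddharm 2 \<le> oddharm (min j \<lfloor>y\<rfloor>)" using assms y by (intro oddharm_mono_abs) auto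
  ultimately have "\<mu> j * (1 / 3) \<le> \<mu> j * (oddharm (min j \<lfloor>y\<rfloor>) - 1)"
    using assms by (intro mult_left_mono \<mu>_nonneg) auto
  also have "\<dots> = (\<Sum>j\<in>{j}. \<mu> j * (oddharm (min j \<lfloor>y\<rfloor>) - 1))" by simp
  also have "\<dots> \<le> infsum (\<lambda>j. \<mu> j * (oddharm (min j \<lfloor>y\<rfloor>) - 1)) {1..}"
    by (rule finite_sum_le_infsum[OF L_summable]) (use assms y oddharm_clamp_ge_1 \<mu>_nonneg in auto)
  finally show ?thesis unfolding L_def by (rule mult_left_mono) simp
qed

text \<open>For fixed \<open>j\<close> the clamped term stays bounded in \<open>k\<close>, so it is
  negligible against \<open>oddharm k\<close>; the quotients never exceed 1, and dominated
  convergence applies.\<close>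

lemma L_over_oddharm: "(\<lambda>k. L (real k) / oddharm (int k)) \<longlonglongrightarrow> 0"
proof -
  have "(\<lambda>k. infsum (\<lambda>j. \<mu> j * ((oddharm (min j (int k)) - 1) / oddharm (int k))) {1..}) \<longlonglongrightarrow> 0"
  proof (rule dominated_infsum_tendsto_0[OF \<mu>_summable, where C=1])
    show "\<forall>\<^sub>F k in sequentially. \<forall>j\<in>{1..}. \<bar>(oddharm (min j (int k)) - 1) / oddharm (int k)\<bar> \<le> 1"
      using eventually_ge_at_top[of 1]
    proof (eventually_elim, intro ballI)
      fix k :: nat and j :: int assume k: "1 \<le> k" and j: "j \<in> {1..}"
      have "oddharm (int k) \<ge> 1" using k by (intro oddharm_ge_1) simp
      moreover have "oddharm (min j (int k)) \<le> oddharm (int k)" using j k by (intro oddharm_mono_abs) auto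
      moreover have "oddharm (min j (int k)) \<ge> 1" using j k by (intro oddharm_clamp_ge_1) auto
      ultimately show "\<bar>(oddharm (min j (int k)) - 1) / oddharm (int k)\<bar> \<le> 1" by simp
    qed
    show "(\<lambda>k. (oddharm (min j (int k)) - 1) / oddharm (int k)) \<longlonglongrightarrow> 0" if "j \<in> {1..}" for j
    proof (rule bounded_over_oddharm)
      show "\<forall>\<^sub>F k in sequentially. \<bar>oddharm (min j (int k)) - 1\<bar> \<le> 1 + oddharm j"
        using eventually_ge_at_top[of 1]
      proof eventually_elim
        case (elim k)
        have "oddharm (min j (int k)) \<le> oddharm j" using elim that by (intro oddharm_mono_abs) auto
        then show ?case using oddharm_nonneg[of "min j (int k)"] by linarith
      qed
    qed
  qed (use \<mu>_nonneg in auto)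
  from tendsto_mult[OF tendsto_const this, of "4 / pi ^ 2"]
  have "(\<lambda>k. 4 / pi ^ 2 * infsum (\<lambda>j. \<mu> j * ((oddharm (min j (int k)) - 1) / oddharm (int k))) {1..}) \<longlonglongrightarrow> 0"
    by simp
  moreover have "4 / pi ^ 2 * infsum (\<lambda>j. \<mu> j * ((oddharm (min j (int k)) - 1) / oddharm (int k))) {1..}
      = L (real k) / oddharm (int k)" for k
    using infsum_cmult_left'[of "\<lambda>j. \<mu> j * (oddharm (min j (int k)) - 1)" "inverse (oddharm (int k))" "{1..}"]
    by (simp add: L_def divide_inverse mult.assoc)
  ultimately show ?thesis by (simp only:)
qed

text \<open>Total mass 1 allows \<open>mkernel 1 k\<close> to be distributed over the sum. In
  \<open>mkernel 1 k - mkernel j k\<close> the terms \<open>oddharm k\<close> cancel, leaving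
  \<open>oddharm (min j k) - 1\<close> and two errors that are at most 1 and tend to 0.\<close>

lemma \<nu>_minus_L:
  assumes "\<sigma> = 1"
  shows "(\<lambda>k. real k ^ 2 * \<nu> (- int k - 1) - L (real k)) \<longlonglongrightarrow> 0"
proof -
  let ?e = "\<lambda>j k. mkernel j (int k) - (oddharm (int k) - oddharm (min j (int k)))"
  have "(\<lambda>k. infsum (\<lambda>j. \<mu> j * (?e 1 k - ?e j k)) {1..}) \<longlonglongrightarrow> 0"
  proof (rule dominated_infsum_tendsto_0[OF \<mu>_summable, where C=2])
    show "\<forall>\<^sub>F k in sequentially. \<forall>j\<in>{1..}. \<bar>?e 1 k - ?e j k\<bar> \<le> 2"
      using eventually_ge_at_top[of 1]
    proof (eventually_elim, intro ballI)
      fix k :: nat and j :: int assume "1 \<le> k" "j \<in> {1..}"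
      then have "\<bar>?e 1 k\<bar> \<le> 1" "\<bar>?e j k\<bar> \<le> 1" by (intro mkernel_bound; simp)+
      then show "\<bar>?e 1 k - ?e j k\<bar> \<le> 2" by linarith
    qed
    show "(\<lambda>k. ?e 1 k - ?e j k) \<longlonglongrightarrow> 0" if "j \<in> {1..}" for j
      using tendsto_diff[OF mkernel_limit[of 1] mkernel_limit[of j]] that by simp
  qed (use \<mu>_nonneg in auto)
  from tendsto_mult[OF tendsto_const this, of "4 / pi ^ 2"]
  have "(\<lambda>k. 4 / pi ^ 2 * infsum (\<lambda>j. \<mu> j * (?e 1 k - ?e j k)) {1..}) \<longlonglongrightarrow> 0" by simp
  moreover have "\<forall>\<^sub>F k in sequentially. 4 / pi ^ 2 * infsum (\<lambda>j. \<mu> j * (?e 1 k - ?e j k)) {1..}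
      = real k ^ 2 * \<nu> (- int k - 1) - L (real k)"
    using eventually_ge_at_top[of 1]
  proof eventually_elim
    case (elim k)
    let ?M = "pi ^ 2 / 4 * of_int (int k) ^ 2 * \<nu> (- int k - 1)"
    have "((\<lambda>j. \<mu> j * mkernel 1 (int k) - \<mu> j * mkernel j (int k) - \<mu> j * (oddharm (min j \<lfloor>real k\<rfloor>) - 1)) has_sum
       (\<sigma> * mkernel 1 (int k) - (mkernel 1 (int k) - ?M) - infsum (\<lambda>j. \<mu> j * (oddharm (min j \<lfloor>real k\<rfloor>) - 1)) {1..})) {1..}"
      by (intro has_sum_diff_real has_sum_cmult_left \<mu>_mkernel_has_sum \<mu>_has_sum has_sum_infsum L_summable) (use elim in simp)
    then have "((\<lambda>j. \<mu> j * (?e 1 k - ?e j k)) has_sum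
       (\<sigma> * mkernel 1 (int k) - (mkernel 1 (int k) - ?M) - infsum (\<lambda>j. \<mu> j * (oddharm (min j \<lfloor>real k\<rfloor>) - 1)) {1..})) {1..}"
      by (rule has_sum_cong[THEN iffD1, rotated]) (use elim in \<open>simp add: algebra_simps min_absorb1\<close>)
    note i = infsumI[OF this]
    have a: "4 / p * (1 * m - (m - p / 4 * K * n) - I) = K * n - 4 / p * I" if "p \<noteq> 0" for p m K n I :: real
      using that by (simp add: field_simps)
    show ?case unfolding i L_def assms by (subst a) simp_all
  qed
  ultimately show ?thesis by (rule Lim_transform_eventually)
qed

lemma L_slowly_varying:
  assumes j: "j \<ge> 2" "\<mu> j > 0"
  shows "slowly_varying L"
proof -
  define c0 where "c0 = 4 / pi ^ 2 * (\<mu> j * (1 / 3))"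
  have c0: "c0 > 0" using j by (simp add: c0_def)
  have low: "\<forall>\<^sub>F y in at_top. L y \<ge> c0"
    using eventually_ge_at_top[of 2] by eventually_elim (use L_lower[OF j(1)] in \<open>simp add: c0_def\<close>)
  have *: "((\<lambda>y. L (c * y) / L y) \<longlongrightarrow> 1) at_top" if c: "c \<ge> 1" for c
  proof (rule ratio_tendsto_1[OF _ c0 low])
    show "((\<lambda>y. L (c * y) - L y) \<longlongrightarrow> 0) at_top"
    proof (rule L_diff_tendsto_0)
      show "filterlim (\<lambda>y. \<lfloor>c * y\<rfloor>) at_top at_top" using c by (intro filterlim_floor) simp
      show "filterlim (\<lambda>y::real. \<lfloor>y\<rfloor>) at_top at_top" using filterlim_floor[of 1] by simp
      show "\<forall>\<^sub>F y in at_top. \<bar>oddharm \<lfloor>c * y\<rfloor> - oddharm \<lfloor>y\<rfloor>\<bar> \<le> c"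
        using eventually_ge_at_top[of 2]
      proof eventually_elim
        case (elim y)
        have "y \<le> c * y" using elim c by simp
        then have f: "\<lfloor>y\<rfloor> \<le> \<lfloor>c * y\<rfloor>" by (rule floor_mono)
        have y1: "\<lfloor>y\<rfloor> \<ge> 1" using elim by linarith
        \<comment> \<open>With this the bound from \<open>oddharm_diff_le\<close>, whose denominator
          is twice the floor of \<open>y\<close>, becomes the constant \<open>c\<close>.\<close>
        have "y \<le> 2 * of_int \<lfloor>y\<rfloor>" using elim by linarith
        then have "c * y \<le> c * (2 * of_int \<lfloor>y\<rfloor>)" using c by (intro mult_left_mono) auto
        moreover have "of_int \<lfloor>c * y\<rfloor> \<le> c * y" by simp
        moreover have "0 \<le> real_of_int \<lfloor>y\<rfloor>" using y1 by simp
        ultimately have "of_int \<lfloor>c * y\<rfloor> - of_int \<lfloor>y\<rfloor> \<le> c * (2 * of_int \<lfloor>y\<rfloor>)" by linarith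
        then have "(of_int \<lfloor>c * y\<rfloor> - of_int \<lfloor>y\<rfloor>) / (2 * of_int \<lfloor>y\<rfloor>) \<le> c"
          using y1 by (subst pos_divide_le_eq) auto
        then have "oddharm \<lfloor>c * y\<rfloor> - oddharm \<lfloor>y\<rfloor> \<le> c"
          using oddharm_diff_le[OF y1 f] by linarith
        moreover have "oddharm \<lfloor>y\<rfloor> \<le> oddharm \<lfloor>c * y\<rfloor>" using f y1 by (intro oddharm_mono_abs) auto
        ultimately show ?case by simp
      qed
    qed
  qed
  show ?thesis unfolding slowly_varying_def
  proof (intro allI impI)
    fix c :: real assume c: "c > 0"
    show "((\<lambda>y. L (c * y) / L y) \<longlongrightarrow> 1) at_top"
    proof (cases "c \<ge> 1")
      \<comment> \<open>For \<open>c < 1\<close> the ratio is the inverse of the one for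
        \<open>1 / c\<close>, taken along \<open>c * y\<close>.\<close>
      case False
      have "filterlim (\<lambda>y. c * y) at_top at_top"
        using c by (rule filterlim_tendsto_pos_mult_at_top[OF tendsto_const _ filterlim_ident])
      from filterlim_compose[OF *[of "1 / c"] this]
      have "((\<lambda>y. L (1 / c * (c * y)) / L (c * y)) \<longlongrightarrow> 1) at_top" using c False by simp
      from tendsto_inverse[OF this] show ?thesis using c by simp
    qed (rule *)
  qed
qed

lemma case_eq_1:
  assumes \<sigma>: "\<sigma> = 1" and j: "j \<ge> 2" "\<mu> j > 0"
  shows "slowly_varying L"
    and "(\<lambda>k::nat. L (real k)) \<in> o(\<lambda>k. ln (real k))"
    and "(\<lambda>k::nat. 1::real) \<in> O(\<lambda>k. L (real k))"
    and "(\<lambda>k::nat. \<nu> (- int k)) \<sim>[at_top] (\<lambda>k. L (real k) / (real k)^2)"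
proof -
  define c0 where "c0 = 4 / pi ^ 2 * (\<mu> j * (1 / 3))"
  have c0: "c0 > 0" using j by (simp add: c0_def)
  have low: "L y \<ge> c0" if "y \<ge> 2" for y using L_lower[OF j(1) that] by (simp add: c0_def)
  show "slowly_varying L" by (rule L_slowly_varying[OF j])
  show "(\<lambda>k::nat. L (real k)) \<in> o(\<lambda>k. ln (real k))"
  proof (rule smalloI_tendsto)
    have "(\<lambda>k. L (real k) / oddharm (int k) * (oddharm (int k) / ln (real k))) \<longlonglongrightarrow> 0 * (1 / 2)"
      by (intro tendsto_mult L_over_oddharm oddharm_over_ln)
    moreover have "\<forall>\<^sub>F k in sequentially. L (real k) / oddharm (int k) * (oddharm (int k) / ln (real k)) = L (real k) / ln (real k)"
      using eventually_ge_at_top[of 1]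
    proof eventually_elim
      case (elim k)
      then show ?case using oddharm_ge_1[of "int k"] by simp
    qed
    ultimately show "(\<lambda>k. L (real k) / ln (real k)) \<longlonglongrightarrow> 0" by (simp add: Lim_transform_eventually)
    show "\<forall>\<^sub>F k in sequentially. ln (real k) \<noteq> 0"
      using eventually_gt_at_top[of 1] by eventually_elim simp
  qed
  show "(\<lambda>k::nat. 1::real) \<in> O(\<lambda>k. L (real k))"
  proof (rule bigoI[where c="1 / c0"])
    show "\<forall>\<^sub>F k in sequentially. norm (1::real) \<le> 1 / c0 * norm (L (real k))"
      using eventually_ge_at_top[of 2]
    proof eventually_elim
      case (elim k)
      then have "c0 \<le> L (real k)" by (intro low) simp
      then show ?case using c0 by (simp add: le_divide_eq)
    qed
  qed
  have ev: "\<forall>\<^sub>F k in sequentially. L (real (Suc k)) \<ge> c0" "\<forall>\<^sub>F k in sequentially. L (real k) \<ge> c0"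
    using eventually_ge_at_top[of 2] by (eventually_elim, intro low, simp)+
  have 1: "(\<lambda>k. real k ^ 2 * \<nu> (- int k - 1) / L (real k)) \<longlonglongrightarrow> 1"
    by (rule ratio_tendsto_1[OF \<nu>_minus_L[OF \<sigma>] c0 ev(2)])
  \<comment> \<open>\<open>\<nu>_minus_L\<close> compares \<open>\<nu> (- k - 1)\<close> with
    \<open>L\<close> at \<open>k\<close>; passing to \<open>L\<close> at \<open>k + 1\<close> costs
    this ratio of neighbouring values.\<close>
  have 2: "(\<lambda>k. L (real k) / L (real (Suc k))) \<longlonglongrightarrow> 1"
  proof (rule ratio_tendsto_1[OF _ c0 ev(1)], rule L_diff_tendsto_0)
    show "filterlim (\<lambda>k. \<lfloor>real k\<rfloor>) at_top sequentially" "filterlim (\<lambda>k. \<lfloor>real (Suc k)\<rfloor>) at_top sequentially"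
      using filterlim_int_plus[of 0] filterlim_int_plus[of 1] by (simp_all add: add.commute)
    show "\<forall>\<^sub>F k in sequentially. \<bar>oddharm \<lfloor>real k\<rfloor> - oddharm \<lfloor>real (Suc k)\<rfloor>\<bar> \<le> 1"
    proof (rule always_eventually, rule allI)
      fix k
      have "oddharm (int k + 1) = oddharm (int k) + 1 / (2 * of_int (int k) + 1)" by (rule oddharm_step)
      then show "\<bar>oddharm \<lfloor>real k\<rfloor> - oddharm \<lfloor>real (Suc k)\<rfloor>\<bar> \<le> 1" by (simp add: add.commute)
    qed
  qed
  have 3: "(\<lambda>k. real (Suc k) ^ 2 / real k ^ 2) \<longlonglongrightarrow> 1" by real_asymp
  show "(\<lambda>k::nat. \<nu> (- int k)) \<sim>[at_top] (\<lambda>k. L (real k) / (real k)^2)"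
  proof (rule asymp_equivI')
    have "(\<lambda>k. real k ^ 2 * \<nu> (- int k - 1) / L (real k) * (L (real k) / L (real (Suc k))) * (real (Suc k) ^ 2 / real k ^ 2)) \<longlonglongrightarrow> 1 * 1 * 1"
      by (intro tendsto_mult 1 2 3)
    moreover have "\<forall>\<^sub>F k in sequentially. real k ^ 2 * \<nu> (- int k - 1) / L (real k) * (L (real k) / L (real (Suc k))) * (real (Suc k) ^ 2 / real k ^ 2)
       = \<nu> (- int (Suc k)) / (L (real (Suc k)) / (real (Suc k))^2)"
      using ev eventually_ge_at_top[of 1]
    proof eventually_elim
      case (elim k)
      have e: "- int (Suc k) = - int k - 1" by simp
      have "K * n / l * (l / l') * (K' / K) = n / (l' / K')"
        if "K \<noteq> 0" "l \<noteq> 0" for K n l l' K' :: real using that by simp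
      from this[of "real k ^ 2" "L (real k)" "\<nu> (- int k - 1)" "L (real (Suc k))" "real (Suc k) ^ 2"]
      show ?case unfolding e using elim c0 by simp
    qed
    ultimately have "(\<lambda>k. \<nu> (- int (Suc k)) / (L (real (Suc k)) / (real (Suc k))^2)) \<longlonglongrightarrow> 1 * 1 * 1"
      by (rule Lim_transform_eventually)
    then show "(\<lambda>k. \<nu> (- int k) / (L (real k) / (real k)^2)) \<longlonglongrightarrow> 1"
      unfolding mult_1 by (rule LIMSEQ_imp_Suc)
  qed
qed

text \<open>Here the Dirac mass is excluded: if \<open>\<mu>\<close> had its whole mass 1 at
  \<open>j = 1\<close>, then \<open>\<nu> 0 \<ge> 1\<close>, and no mass would be left
  elsewhere.\<close>

lemma \<mu>_nontrivial:
  assumes \<sigma>: "\<sigma> = 1" and not_dirac: "\<nu> \<noteq> (\<lambda>k. if k = 0 then 1 else 0)"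
  shows "\<exists>j\<ge>2. \<mu> j > 0"
proof (rule ccontr)
  assume "\<not> (\<exists>j\<ge>2. \<mu> j > 0)"
  then have z: "\<mu> j = 0" if "j \<ge> 2" for j using \<mu>_nonneg[of j] that by force
  have "(\<mu> has_sum \<mu> 1) {1..}"
    by (rule has_sum_finite_neutralI[of "{1}"]) (use z in auto)
  then have "\<mu> 1 = 1" using has_sum_unique[OF \<mu>_has_sum] \<sigma> by simp
  then have n0: "\<nu> 0 \<ge> 1" using nonneg[of "- 2"] by (simp add: \<mu>_def \<delta>_def)
  have le: "sum \<nu> F \<le> 1" if "finite F" for F
    by (rule finite_sum_le_has_sum[OF prob that]) (auto simp: nonneg)
  have "\<nu> k = (if k = 0 then 1 else 0)" for k
  proof (cases "k = 0")
    case True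
    then show ?thesis using n0 le[of "{0}"] by simp
  next
    case False
    then show ?thesis using n0 le[of "{0, k}"] nonneg[of k] by simp
  qed
  then show False using not_dirac by blast
qed

end

section \<open>Combination of the two regimes of \<open>\<sigma>\<close>\<close>

theorem theorem1p2:
  fixes \<nu> :: "int \<Rightarrow> real"
  assumes nonneg: "\<And>k. \<nu> k \<ge> 0"
    and prob: "(\<nu> has_sum 1) UNIV"
    and harmonic: "\<And>p. p \<ge> 1 \<Longrightarrow> ((\<lambda>k. \<nu> k * hdown (p + k)) has_sum hdown p) UNIV"
    and not_dirac: "\<nu> \<noteq> (\<lambda>k. if k = 0 then 1 else 0)"
    and dom: "\<And>k::int. k \<ge> 1 \<Longrightarrow> \<nu> (k - 1) \<ge> \<nu> (- k - 1)"
  defines "D \<equiv> (\<lambda>k::int. of_int k * (\<nu> (k - 1) - \<nu> (- k - 1)))"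
  defines "P1 \<equiv> (\<exists>s. (D has_sum s) {1..} \<and> 0 \<le> s \<and> s < 1) \<and>
                 (\<exists>c>0. (\<lambda>k::nat. \<nu> (- int k)) \<sim>[at_top] (\<lambda>k. c * ln (real k) / (real k)^2))"
  defines "P2 \<equiv> (D has_sum 1) {1..} \<and>
                 (\<exists>L. slowly_varying L \<and>
                      (\<lambda>k::nat. L (real k)) \<in> o(\<lambda>k. ln (real k)) \<and>
                      (\<lambda>k::nat. 1::real) \<in> O(\<lambda>k. L (real k)) \<and>
                      (\<lambda>k::nat. \<nu> (- int k)) \<sim>[at_top] (\<lambda>k. L (real k) / (real k)^2))"
  shows "(P1 \<and> \<not> P2) \<or> (P2 \<and> \<not> P1)"
proof -
  interpret hdown_harmonic_dominated \<nu>
    by unfold_locales (fact nonneg prob harmonic dom)+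
  have D: "D = \<mu>" by (simp add: D_def \<mu>_def[abs_def] \<delta>_def)
  \<comment> \<open>The alternatives prescribe different values for one and the same sum.\<close>
  have excl: "\<not> (P1 \<and> P2)"
  proof
    assume "P1 \<and> P2"
    then obtain t where "(D has_sum t) {1..}" "t < 1" "(D has_sum 1) {1..}"
      unfolding P1_def P2_def by blast
    then show False using has_sum_unique[of D "{1..}" t 1] by simp
  qed
  have "P1 \<or> P2"
  proof (cases "\<sigma> < 1")
    case True
    have "2 / pi ^ 2 * (1 - \<sigma>) > 0" using True by simp
    then have P1 unfolding P1_def D using \<mu>_has_sum \<sigma>_bounds(1) True case_less_1[OF True]
      by (intro conjI exI[of _ \<sigma>] exI[of _ "2 / pi ^ 2 * (1 - \<sigma>)"])
    then show ?thesis ..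
  next
    case False
    then have \<sigma>: "\<sigma> = 1" using \<sigma>_bounds(2) by simp
    obtain j where "j \<ge> 2" "\<mu> j > 0" using \<mu>_nontrivial[OF \<sigma> not_dirac] by blast
    from case_eq_1[OF \<sigma> this] have P2
      unfolding P2_def D using \<mu>_has_sum[unfolded \<sigma>] by (intro conjI exI[of _ L])
    then show ?thesis ..
  qed
  with excl show ?thesis by blast
qed

end
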